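(* The random sequence $\Lambda(\omega)$ is almost surely interpolating for $\mathcal{D}$ if and only if it is almost surely a zero sequence for $\mathcal{D}$.
   Context: $\mathbb{D}$ is the open unit disk. Random sequence: $(\rho_n)\subset[0,1)$ is a fixed (deterministic) sequence of radii, $(\theta_n(\omega))$ is a sequence of independent random variables, all uniformly distributed on $[0,2\pi]$, and $\Lambda(\omega)=\{\lambda_n\}$ is the set of points $\lambda_n=\rho_n e^{i\theta_n(\omega)}$. $\mathcal{D}=\mathcal{D}_1$ is the classical Dirichlet space of analytic functions $f$ on $\mathbb{D}$ with $\|f\|^2=|f(0)|^2+\int_{\mathbb{D}}|f'|^2\,dA<\infty$, $dA=dx\,dy/\pi$, with reproducing kernel (for an equivalent norm) $k_z(w)=\frac{1}{\overline{z}w}\log\frac{1}{1-\overline{z}w}$ (equal to $1$ when $\overline{z}w=0$), and $\|k_\lambda\|^2=k_\lambda(\lambda)$. "Interpolating" always means universal interpolating: a set $\Lambda$ of distinct points of $\mathbb{D}$ is (universal) interpolating for $\mathcal{D}$ if the map $R_\Lambda: f\mapsto (f(\lambda)/\|k_\lambda\|)_{\lambda\in\Lambda}$ is well defined from $\mathcal{D}$ into $\ell^2(\Lambda)$ and is onto $\ell^2(\Lambda)$. $\Lambda$ is a zero sequence for $\mathcal{D}$ if there is a function $f\in\mathcal{D}$, not identically zero, vanishing at every point of $\Lambda$. *)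

theory Defs
  imports "HOL-Complex_Analysis.Complex_Analysis" "HOL-Probability.Probability"
begin

text \<open>Functions on the disk are total functions of type \<open>complex \<Rightarrow> complex\<close>; only their values
  on the open unit disk \<open>ball 0 1\<close> matter.\<close>

definition dirichlet_norm_sq :: "(complex \<Rightarrow> complex) \<Rightarrow> ennreal" where
  "dirichlet_norm_sq f =
     ennreal ((cmod (f 0))\<^sup>2) +
     ennreal (1 / pi) * (\<integral>\<^sup>+ z \<in> ball 0 1. ennreal ((cmod (deriv f z))\<^sup>2) \<partial>lborel)"

definition dirichlet_space :: "(complex \<Rightarrow> complex) set" where
  "dirichlet_space = {f. f holomorphic_on ball 0 1 \<and> dirichlet_norm_sq f < \<infinity>}"

text \<open>The kernel reproduces point evaluations with respect to an equivalent norm, not with respect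
  to \<open>dirichlet_norm_sq\<close>. For \<open>z\<close>, \<open>w\<close> in the disk the argument of \<open>Ln\<close> lies in the right
  half-plane, so the principal branch is the intended one.\<close>

definition dirichlet_kernel :: "complex \<Rightarrow> complex \<Rightarrow> complex" where
  "dirichlet_kernel z w =
     (if cnj z * w = 0 then 1 else 1 / (cnj z * w) * Ln (1 / (1 - cnj z * w)))"

text \<open>\<open>dirichlet_kernel z z\<close> is a positive real for \<open>z\<close> in the disk; it is the squared norm of the
  kernel at \<open>z\<close>.\<close>

definition kernel_norm :: "complex \<Rightarrow> real" where
  "kernel_norm z = sqrt (Re (dirichlet_kernel z z))"

text \<open>Families indexed by \<open>\<Lambda>\<close> are functions that are \<open>undefined\<close> outside \<open>\<Lambda>\<close>.\<close>

definition ell2 :: "complex set \<Rightarrow> (complex \<Rightarrow> complex) set" where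
  "ell2 \<Lambda> = {a \<in> extensional \<Lambda>. (\<lambda>x. (cmod (a x))\<^sup>2) summable_on \<Lambda>}"

definition restriction_map :: "complex set \<Rightarrow> (complex \<Rightarrow> complex) \<Rightarrow> complex \<Rightarrow> complex" where
  "restriction_map \<Lambda> f = (\<lambda>x\<in>\<Lambda>. f x / of_real (kernel_norm x))"

definition universal_interpolating :: "complex set \<Rightarrow> bool" where
  "universal_interpolating \<Lambda> \<longleftrightarrow>
     \<Lambda> \<subseteq> ball 0 1 \<and>
     restriction_map \<Lambda> \<in> dirichlet_space \<rightarrow> ell2 \<Lambda> \<and>
     restriction_map \<Lambda> ` dirichlet_space = ell2 \<Lambda>"

definition zero_sequence :: "complex set \<Rightarrow> bool" where
  "zero_sequence \<Lambda> \<longleftrightarrow>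
     \<Lambda> \<subseteq> ball 0 1 \<and>
     (\<exists>f \<in> dirichlet_space. (\<exists>z \<in> ball 0 1. f z \<noteq> 0) \<and> (\<forall>x \<in> \<Lambda>. f x = 0))"

text \<open>A set, so points coinciding for different \<open>n\<close> (such as \<open>\<rho> n = 0\<close> for several \<open>n\<close>) are
  counted once.\<close>

definition random_points :: "(nat \<Rightarrow> real) \<Rightarrow> (nat \<Rightarrow> 'w \<Rightarrow> real) \<Rightarrow> 'w \<Rightarrow> complex set" where
  "random_points \<rho> \<theta> \<omega> = range (\<lambda>n. rcis (\<rho> n) (\<theta> n \<omega>))"

end

theory Submission
  imports Defs
begin

text \<open>
  Write \<open>k\<^sub>\<lambda>\<close> for the kernel at \<open>\<lambda>\<close>. Both properties are governed by one number, the sum of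
  \<open>1 / \<parallel>k\<^sub>\<lambda>\<parallel>\<^sup>2\<close> over the points \<open>\<lambda> \<noteq> 0\<close>, which depends on the radii alone. The proof goes from
  interpolating to zero sequence, from almost surely zero to finiteness of the sum, and from finiteness
  back to almost surely interpolating.

  \<^item> An interpolating set is a zero set, whatever the points: interpolate \<open>1\<close> at one point and \<open>0\<close> at the
    others, and multiply by one linear factor (\<open>universal_interpolating_imp_zero_sequence\<close>).

  \<^item> Suppose that the sum diverges. Let \<open>D\<^sub>N\<close> be the squared distance from the kernel at \<open>0\<close> to the span
    of the first \<open>N\<close> kernels and \<open>h\<close> the corresponding residual, so that \<open>h(0) = \<parallel>h\<parallel>\<^sup>2 = D\<^sub>N\<close>. The next point
    \<open>\<lambda>\<close> lowers \<open>D\<^sub>N\<close> by at least \<open>\<bar>h(\<lambda>)\<bar>\<^sup>2 / \<parallel>k\<^sub>\<lambda>\<parallel>\<^sup>2\<close>; its angle is independent of \<open>h\<close>, and the circular mean of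
    \<open>\<bar>h\<bar>\<^sup>2\<close> is at least \<open>\<bar>h(0)\<bar>\<^sup>2 = D\<^sub>N\<^sup>2\<close>. Summing the expected decreases bounds the sum of
    \<open>E D\<^sub>N\<^sup>2 / \<parallel>k\<^sub>\<lambda>\<parallel>\<^sup>2\<close> by \<open>1\<close>, hence \<open>D\<^sub>N\<close> tends to \<open>0\<close> almost surely. But a function in the space that
    vanishes at all points and not at \<open>0\<close> is orthogonal to all these kernels, which keeps \<open>D\<^sub>N\<close> away from \<open>0\<close>
    (\<open>kernel_dist_mean_decrease\<close>, \<open>kernel_dist_lower_bound\<close>, \<open>summable_weights_if_AE_zero_sequence\<close>).

  \<^item> Suppose that the sum converges. The mean of \<open>\<bar>k\<^sub>\<lambda>\<bar>\<^sup>2\<close> over any circle is at most the sum of \<open>1 / n\<^sup>2\<close>, so the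
    squared off-diagonal entries of the Gram matrix of the normalised kernels have summable expectations:
    the Gram matrix is almost surely the identity plus a Hilbert-Schmidt matrix. Far out in the sequence
    the Hilbert-Schmidt norm is at most \<open>1/2\<close>, and there a Neumann series solves every interpolation problem.
    The finitely many remaining points can be added one at a time, because for each of them some function
    vanishes at the points already present but not there (\<open>nearly_orthonormal_solution\<close>,
    \<open>universal_interpolating_insert\<close>, \<open>AE_universal_interpolating\<close>).

  The space is realised as the Hilbert space of square-summable sequences. That its area integral norm is
  a weighted sum of squares of Taylor coefficients rests on the rotation invariance of planar Lebesgue
  measure and on the Parseval identity on circles (\<open>dirichlet_norm_sq_power_series\<close>).
\<close>

section \<open>Square-summable complex sequences\<close>

text \<open>This copy of complex \<open>\<ell>\<^sup>2\<close> is made a real Hilbert space, to match the class \<open>real_inner\<close>; multiplication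
  by complex scalars is the separate operation \<open>cmul\<close>.\<close>

typedef hseq = "{a :: nat \<Rightarrow> complex. summable (\<lambda>n. (cmod (a n))\<^sup>2)}"
  morphisms hnth Hseq
  by (rule exI[of _ "\<lambda>_. 0"]) simp

lemma summable_hnth: "summable (\<lambda>n. (cmod (hnth a n))\<^sup>2)"
  using hnth[of a] by simp

lemma hnth_Hseq: "summable (\<lambda>n. (cmod (a n))\<^sup>2) \<Longrightarrow> hnth (Hseq a) = a"
  by (simp add: Hseq_inverse)

lemma hseq_eqI: "(\<And>n. hnth a n = hnth b n) \<Longrightarrow> a = b"
  by (metis hnth_inject ext)

lemma summable_sq_add:
  fixes a b :: "nat \<Rightarrow> complex"
  assumes "summable (\<lambda>n. (cmod (a n))\<^sup>2)" "summable (\<lambda>n. (cmod (b n))\<^sup>2)"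
  shows "summable (\<lambda>n. (cmod (a n + b n))\<^sup>2)"
proof (rule summable_comparison_test')
  show "summable (\<lambda>n. 2 * (cmod (a n))\<^sup>2 + 2 * (cmod (b n))\<^sup>2)"
    by (intro summable_add summable_mult assms)
  fix n
  have "(cmod (a n + b n))\<^sup>2 \<le> (cmod (a n) + cmod (b n))\<^sup>2"
    by (intro power_mono norm_triangle_ineq) auto
  also have "\<dots> \<le> 2 * (cmod (a n))\<^sup>2 + 2 * (cmod (b n))\<^sup>2"
    using sum_squares_bound[of "cmod (a n)" "cmod (b n)"] by (simp add: power2_sum)
  finally show "norm ((cmod (a n + b n))\<^sup>2) \<le> 2 * (cmod (a n))\<^sup>2 + 2 * (cmod (b n))\<^sup>2"
    by simp
qed

lemma summable_sq_mult:
  fixes a :: "nat \<Rightarrow> complex"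
  assumes "summable (\<lambda>n. (cmod (a n))\<^sup>2)"
  shows "summable (\<lambda>n. (cmod (c * a n))\<^sup>2)"
  using summable_mult[OF assms, of "(cmod c)\<^sup>2"] by (simp add: norm_mult power_mult_distrib)

definition cmul :: "complex \<Rightarrow> hseq \<Rightarrow> hseq" where
  "cmul c a = Hseq (\<lambda>n. c * hnth a n)"

lemma hnth_cmul [simp]: "hnth (cmul c a) n = c * hnth a n"
  by (simp add: cmul_def hnth_Hseq summable_sq_mult summable_hnth)

instantiation hseq :: real_vector
begin

definition "0 = Hseq (\<lambda>_. 0)"
definition "a + b = Hseq (\<lambda>n. hnth a n + hnth b n)"
definition "a - b = Hseq (\<lambda>n. hnth a n - hnth b n)"
definition "- a = Hseq (\<lambda>n. - hnth a n)"
definition "r *\<^sub>R a = cmul (of_real r) a"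

lemma hnth_zero [simp]: "hnth 0 n = 0"
  by (simp add: zero_hseq_def hnth_Hseq)

lemma hnth_add [simp]: "hnth (a + b) n = hnth a n + hnth b n"
  by (simp add: plus_hseq_def hnth_Hseq summable_sq_add summable_hnth)

lemma hnth_uminus [simp]: "hnth (- a) n = - hnth a n"
  by (simp add: uminus_hseq_def hnth_Hseq summable_hnth)

lemma hnth_diff [simp]: "hnth (a - b) n = hnth a n - hnth b n"
proof -
  have "summable (\<lambda>n. (cmod (hnth a n - hnth b n))\<^sup>2)"
    using summable_hnth[of "a + (- b)"] by simp
  then show ?thesis
    by (simp add: minus_hseq_def hnth_Hseq)
qed

lemma hnth_scaleR [simp]: "hnth (r *\<^sub>R a) n = r *\<^sub>R hnth a n"
  by (simp add: scaleR_hseq_def scaleR_conv_of_real)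

instance
  by standard (auto intro!: hseq_eqI simp: algebra_simps)

end

lemma summable_inner_hnth: "summable (\<lambda>n. hnth a n \<bullet> hnth b n)"
proof (rule summable_comparison_test')
  show "summable (\<lambda>n. (cmod (hnth a n))\<^sup>2 + (cmod (hnth b n))\<^sup>2)"
    by (intro summable_add summable_hnth)
  fix n
  have "norm (hnth a n \<bullet> hnth b n) \<le> cmod (hnth a n) * cmod (hnth b n)"
    by (simp add: Cauchy_Schwarz_ineq2)
  also have "\<dots> \<le> (cmod (hnth a n))\<^sup>2 + (cmod (hnth b n))\<^sup>2"
    using sum_squares_bound[of "cmod (hnth a n)" "cmod (hnth b n)"]
      mult_nonneg_nonneg[OF norm_ge_zero[of "hnth a n"] norm_ge_zero[of "hnth b n"]]
    unfolding mult.assoc by linarith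
  finally show "norm (hnth a n \<bullet> hnth b n) \<le> (cmod (hnth a n))\<^sup>2 + (cmod (hnth b n))\<^sup>2" .
qed

instantiation hseq :: real_inner
begin

definition "a \<bullet> b = (\<Sum>n. hnth a n \<bullet> hnth b n)"
definition "norm (a::hseq) = sqrt (a \<bullet> a)"
definition "sgn (a::hseq) = a /\<^sub>R norm a"
definition "dist (a::hseq) b = norm (a - b)"
definition "uniformity = (INF e\<in>{0 <..}. principal {(a::hseq, b). dist a b < e})"
definition "open (U :: hseq set) \<longleftrightarrow> (\<forall>x\<in>U. eventually (\<lambda>(x', y). x' = x \<longrightarrow> y \<in> U) uniformity)"

instance
proof
  fix x y z :: hseq and r :: real
  show "x \<bullet> y = y \<bullet> x"
    by (simp add: inner_hseq_def inner_commute)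
  show "(x + y) \<bullet> z = x \<bullet> z + y \<bullet> z"
    by (simp add: inner_hseq_def inner_add_left suminf_add summable_inner_hnth)
  show "(r *\<^sub>R x) \<bullet> y = r * (x \<bullet> y)"
    by (simp add: inner_hseq_def suminf_mult summable_inner_hnth)
  show "0 \<le> x \<bullet> x"
    unfolding inner_hseq_def by (intro suminf_nonneg summable_inner_hnth) simp
  show "(x \<bullet> x = 0) = (x = 0)"
  proof
    assume "x \<bullet> x = 0"
    then have "\<forall>n. hnth x n \<bullet> hnth x n = 0"
      unfolding inner_hseq_def by (subst (asm) suminf_eq_zero_iff) (auto intro: summable_inner_hnth)
    then show "x = 0"
      by (intro hseq_eqI) simp
  qed (simp add: inner_hseq_def)
qed (simp_all add: norm_hseq_def sgn_hseq_def dist_hseq_def uniformity_hseq_def open_hseq_def)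

end

lemma norm_hseq_sq: "(norm a)\<^sup>2 = (\<Sum>n. (cmod (hnth a n))\<^sup>2)"
  by (simp add: power2_norm_eq_inner inner_hseq_def)

lemma sum_sq_hnth_le: "(\<Sum>n<k. (cmod (hnth a n))\<^sup>2) \<le> (norm a)\<^sup>2"
  unfolding norm_hseq_sq by (rule sum_le_suminf) (auto intro: summable_hnth)

lemma cmod_hnth_le: "cmod (hnth a n) \<le> norm a"
proof (rule power2_le_imp_le)
  have "(cmod (hnth a n))\<^sup>2 \<le> (\<Sum>n<Suc n. (cmod (hnth a n))\<^sup>2)"
    by (simp add: sum_nonneg)
  then show "(cmod (hnth a n))\<^sup>2 \<le> (norm a)\<^sup>2"
    using sum_sq_hnth_le[of a "Suc n"] by linarith
qed simp

lemma norm_hseq_leI: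
  assumes "\<And>k. (\<Sum>n<k. (cmod (hnth a n))\<^sup>2) \<le> r\<^sup>2" "0 \<le> r"
  shows "norm a \<le> r"
proof (rule power2_le_imp_le)
  show "(norm a)\<^sup>2 \<le> r\<^sup>2"
    unfolding norm_hseq_sq by (intro suminf_le_const summable_hnth assms)
qed fact

lemma norm_cmul: "norm (cmul c a) = cmod c * norm a"
proof (rule power2_eq_imp_eq)
  show "(norm (cmul c a))\<^sup>2 = (cmod c * norm a)\<^sup>2"
    by (simp add: norm_hseq_sq power_mult_distrib norm_mult suminf_mult summable_hnth)
qed simp_all

text \<open>The limit of a Cauchy sequence is formed coordinatewise; the bound on partial sums of squares
  survives that limit.\<close>

instance hseq :: complete_space
proof
  fix X :: "nat \<Rightarrow> hseq"
  assume X: "Cauchy X"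
  have "Cauchy (\<lambda>m. hnth (X m) n)" for n
  proof (rule metric_CauchyI)
    fix e :: real assume "0 < e"
    then obtain M where M: "\<And>m n. m \<ge> M \<Longrightarrow> n \<ge> M \<Longrightarrow> dist (X m) (X n) < e"
      using metric_CauchyD[OF X] by blast
    have "dist (hnth (X m) n) (hnth (X m') n) < e" if "m \<ge> M" "m' \<ge> M" for m m'
      using cmod_hnth_le[of "X m - X m'" n] M[OF that] by (simp add: dist_norm)
    then show "\<exists>M. \<forall>m\<ge>M. \<forall>m'\<ge>M. dist (hnth (X m) n) (hnth (X m') n) < e" by blast
  qed
  then have "\<exists>l. \<forall>n. (\<lambda>m. hnth (X m) n) \<longlonglongrightarrow> l n"
    by (intro choice) (simp add: Cauchy_convergent_iff convergent_def)
  then obtain l where l: "\<And>n. (\<lambda>m. hnth (X m) n) \<longlonglongrightarrow> l n"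
    by blast
  have close: "\<exists>M. \<forall>m\<ge>M. \<forall>k. (\<Sum>n<k. (cmod (hnth (X m) n - l n))\<^sup>2) \<le> e\<^sup>2" if "0 < e" for e :: real
  proof -
    obtain M where M: "\<And>m n. m \<ge> M \<Longrightarrow> n \<ge> M \<Longrightarrow> dist (X m) (X n) < e"
      using metric_CauchyD[OF X \<open>0 < e\<close>] by blast
    have "(\<Sum>n<k. (cmod (hnth (X m) n - l n))\<^sup>2) \<le> e\<^sup>2" if "m \<ge> M" for m k
    proof (rule tendsto_upperbound)
      show "(\<lambda>m'. \<Sum>n<k. (cmod (hnth (X m) n - hnth (X m') n))\<^sup>2) \<longlonglongrightarrow>
            (\<Sum>n<k. (cmod (hnth (X m) n - l n))\<^sup>2)"
        by (intro tendsto_intros l)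
      have "(\<Sum>n<k. (cmod (hnth (X m) n - hnth (X m') n))\<^sup>2) \<le> e\<^sup>2" if "m' \<ge> M" for m'
      proof -
        have "(norm (X m - X m'))\<^sup>2 \<le> e\<^sup>2"
          using M[OF \<open>m \<ge> M\<close> that] by (intro power_mono) (auto simp: dist_norm)
        then show ?thesis
          using sum_sq_hnth_le[of "X m - X m'" k] by simp
      qed
      then show "\<forall>\<^sub>F m' in sequentially. (\<Sum>n<k. (cmod (hnth (X m) n - hnth (X m') n))\<^sup>2) \<le> e\<^sup>2"
        by (auto simp: eventually_sequentially)
    qed simp
    then show ?thesis by blast
  qed
  obtain M where "\<forall>k. (\<Sum>n<k. (cmod (hnth (X M) n - l n))\<^sup>2) \<le> 1\<^sup>2"
    using close[of 1] by auto
  then have "summable (\<lambda>n. (cmod (hnth (X M) n - l n))\<^sup>2)"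
    by (intro summableI_nonneg_bounded[of _ "1\<^sup>2"]) auto
  from summable_sq_add[OF summable_sq_mult[OF this, of "-1"] summable_hnth[of "X M"]]
  have "summable (\<lambda>n. (cmod (l n))\<^sup>2)"
    by simp
  then have L: "hnth (Hseq l) = l"
    by (rule hnth_Hseq)
  have "X \<longlonglongrightarrow> Hseq l"
  proof (rule metric_LIMSEQ_I)
    fix e :: real assume "0 < e"
    then obtain M where "\<forall>m\<ge>M. \<forall>k. (\<Sum>n<k. (cmod (hnth (X m) n - l n))\<^sup>2) \<le> (e/2)\<^sup>2"
      using close[of "e/2"] by auto
    then have "norm (X m - Hseq l) \<le> e/2" if "m \<ge> M" for m
      using \<open>0 < e\<close> that by (intro norm_hseq_leI) (simp_all add: L)
    then show "\<exists>M. \<forall>m\<ge>M. dist (X m) (Hseq l) < e"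
      using \<open>0 < e\<close> by (intro exI[of _ M]) (force simp: dist_norm)
  qed
  then show "convergent X"
    by (rule convergentI)
qed

instance hseq :: banach ..

section \<open>Circular means\<close>

definition unif :: "real measure" where
  "unif = uniform_measure lborel {0..2 * pi}"

lemma unif_eq_density: "unif = density lborel (\<lambda>x. ennreal (indicator {0..2*pi} x / (2*pi)))"
  unfolding unif_def uniform_measure_def
  by (intro arg_cong2[where f=density] refl ext)
     (simp add: divide_ennreal ennreal_indicator[symmetric] flip: ennreal_indicator)

lemma prob_space_unif: "prob_space unif"
  unfolding unif_def by (rule prob_space_uniform_measure) auto

lemma sets_unif [measurable_cong, simp]: "sets unif = sets borel"
  by (simp add: unif_def)

lemma space_unif [simp]: "space unif = UNIV"
  by (simp add: unif_def)

lemma circle_orthogonal: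
  "(LINT s|unif. cis s ^ n * cnj (cis s ^ m)) = (if n = m then 1 else 0)"
proof (cases "n = m")
  case True
  interpret prob_space unif by (rule prob_space_unif)
  have "cis s ^ n * cnj (cis s ^ m) = 1" for s
    using True by (simp add: complex_norm_square[symmetric] norm_power del: complex_cnj_power)
  with True show ?thesis by (simp add: prob_space[simplified])
next
  case False
  define k where "k = real n - real m"
  have k: "k \<noteq> 0" using False by (simp add: k_def)
  have e: "cis s ^ n * cnj (cis s ^ m) = cis (k * s)" for s
    unfolding Complex.DeMoivre cis_cnj cis_mult k_def
    by (rule arg_cong[where f=cis]) (simp add: algebra_simps)
  have "has_bochner_integral lborel (\<lambda>s. indicator {0..2*pi} s *\<^sub>R cis (k * s))
     (cis (k * (2*pi)) / (\<i> * k) - cis (k * 0) / (\<i> * k))"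
  proof (rule has_bochner_integral_FTC_Icc)
    fix x :: real
    have "((\<lambda>z. exp (\<i> * of_real k * z) / (\<i> * of_real k)) has_field_derivative
        exp (\<i> * of_real k * of_real x)) (at (of_real x))"
      using k by (auto intro!: derivative_eq_intros)
    from has_vector_derivative_real_field[OF this]
    show "((\<lambda>x. cis (k * x) / (\<i> * k)) has_vector_derivative cis (k * x)) (at x within {0..2*pi})"
      by (simp add: cis_conv_exp mult.assoc)
  qed (auto intro!: continuous_intros simp: cis_conv_exp)
  moreover have "cis (k * (2 * pi)) = 1"
  proof -
    have "k \<in> \<int>" by (simp add: k_def)
    from cis_multiple_2pi[OF this] show ?thesis by (subst mult.commute)
  qed
  ultimately have "(LINT s|lborel. indicator {0..2*pi} s *\<^sub>R cis (k * s)) = 0"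
    by (simp add: has_bochner_integral_integral_eq)
  then have "(LINT s|lborel. inverse (2*pi) *\<^sub>R indicator {0..2*pi} s *\<^sub>R cis (k * s)) = 0"
    by (subst integral_scaleR_right) simp
  moreover have "(LINT s|unif. cis (k * s)) = (LINT s|lborel. (indicator {0..2*pi} s / (2*pi)) *\<^sub>R cis (k * s))"
  proof -
    have "(\<lambda>s. cis (k * s)) \<in> borel_measurable borel"
      unfolding cis_conv_exp by (intro borel_measurable_continuous_onI continuous_intros)
    then show ?thesis
      unfolding unif_eq_density by (intro integral_density) auto
  qed
  moreover have "inverse (2*pi) *\<^sub>R indicator {0..2*pi} s *\<^sub>R cis (k * s)
      = (indicator {0..2*pi} s / (2*pi)) *\<^sub>R cis (k * s)" for s
    by (simp only: scaleR_scaleR divide_inverse mult.commute)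
  ultimately have "(LINT s|unif. cis (k * s)) = 0"
    by (simp only:)
  then show ?thesis
    unfolding e using False by simp
qed

text \<open>Parseval's identity: orthogonality gives it for the partial sums, and these converge boundedly
  because the coefficients are absolutely summable.\<close>

lemma circle_mean_sq:
  assumes c: "summable (\<lambda>n. cmod (c n))"
  shows "(\<integral>\<^sup>+ s. ennreal ((cmod (\<Sum>n. c n * cis s ^ n))\<^sup>2) \<partial>unif) = (\<Sum>n. ennreal ((cmod (c n))\<^sup>2))"
proof -
  interpret prob_space unif by (rule prob_space_unif)
  define B where "B = (\<Sum>n. cmod (c n))"
  define P where "P N s = (\<Sum>n<N. c n * cis s ^ n)" for N s
  have cis[measurable]: "cis \<in> borel_measurable borel"
    unfolding cis_conv_exp[abs_def] by (intro borel_measurable_continuous_onI continuous_intros)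
  have meas[measurable]: "P N \<in> borel_measurable borel" for N
    unfolding P_def by measurable
  have Pb: "cmod (P N s) \<le> B" for N s
  proof -
    have "cmod (P N s) \<le> (\<Sum>n<N. cmod (c n))"
      unfolding P_def by (rule sum_norm_le) (simp add: norm_mult norm_power)
    also have "\<dots> \<le> B"
      unfolding B_def by (rule sum_le_suminf[OF c]) auto
    finally show ?thesis .
  qed
  have Plim: "(\<lambda>N. P N s) \<longlonglongrightarrow> (\<Sum>n. c n * cis s ^ n)" for s
    unfolding P_def
    by (intro summable_LIMSEQ summable_norm_cancel[where f="\<lambda>n. c n * cis s ^ n"]) (simp add: norm_mult norm_power c)
  have intb: "integrable unif (\<lambda>s. cis s ^ n * cnj (cis s ^ m))" for n m
  proof (rule integrable_const_bound[where B=1])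
    have [measurable]: "(\<lambda>s. cis s ^ n * cnj (cis s ^ m)) \<in> borel_measurable borel"
      unfolding cis_conv_exp by (intro borel_measurable_continuous_onI continuous_intros)
    show "(\<lambda>s. cis s ^ n * cnj (cis s ^ m)) \<in> borel_measurable unif"
      by measurable
  qed (simp add: norm_mult norm_power)
  have fin: "(LINT s|unif. (cmod (P N s))\<^sup>2) = (\<Sum>n<N. (cmod (c n))\<^sup>2)" for N
  proof -
    have "complex_of_real ((cmod (P N s))\<^sup>2) =
        (\<Sum>n<N. \<Sum>m<N. c n * cnj (c m) * (cis s ^ n * cnj (cis s ^ m)))" for s
      unfolding complex_norm_square P_def cnj_sum sum_product
      by (intro sum.cong refl) (simp add: algebra_simps)
    then have "complex_of_real (LINT s|unif. (cmod (P N s))\<^sup>2) =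
       (LINT s|unif. (\<Sum>n<N. \<Sum>m<N. c n * cnj (c m) * (cis s ^ n * cnj (cis s ^ m))))"
      by (subst integral_complex_of_real[symmetric]) simp
    also have "\<dots> = (\<Sum>n<N. \<Sum>m<N. c n * cnj (c m) * (if n = m then 1 else 0))"
      by (simp add: integral_sum integrable_sum integrable_mult_right intb circle_orthogonal
           del: complex_cnj_power)
    also have "\<dots> = of_real (\<Sum>n<N. (cmod (c n))\<^sup>2)"
      unfolding of_real_sum complex_norm_square
      by (simp add: if_distrib[of "\<lambda>x. _ * x"] sum.delta cong: if_cong)
    finally show ?thesis by (simp only: of_real_eq_iff)
  qed
  define F where "F s = (\<Sum>n. c n * cis s ^ n)" for s
  have F[measurable]: "F \<in> borel_measurable borel"
    unfolding F_def by measurable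
  have Fb: "cmod (F s) \<le> B" for s
    using tendsto_norm[OF Plim[of s]] Pb unfolding F_def by (intro LIMSEQ_le_const2) auto
  have "(\<lambda>N. LINT s|unif. (cmod (P N s))\<^sup>2) \<longlonglongrightarrow> (LINT s|unif. (cmod (F s))\<^sup>2)"
  proof (rule integral_dominated_convergence[where w="\<lambda>_. B\<^sup>2"])
    show "AE s in unif. (\<lambda>N. (cmod (P N s))\<^sup>2) \<longlonglongrightarrow> (cmod (F s))\<^sup>2"
      using Plim unfolding F_def by (intro AE_I2 tendsto_intros) auto
    show "AE s in unif. norm ((cmod (P N s))\<^sup>2) \<le> B\<^sup>2" for N
      using Pb by (intro AE_I2) (auto intro!: power_mono)
  qed auto
  then have lim: "(\<lambda>n. (cmod (c n))\<^sup>2) sums (LINT s|unif. (cmod (F s))\<^sup>2)"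
    by (simp add: fin sums_def)
  have "(\<integral>\<^sup>+ s. ennreal ((cmod (F s))\<^sup>2) \<partial>unif) = ennreal (LINT s|unif. (cmod (F s))\<^sup>2)"
    using Fb by (intro nn_integral_eq_integral integrable_const_bound[where B="B\<^sup>2"])
      (auto intro!: AE_I2 power_mono)
  also have "\<dots> = (\<Sum>n. ennreal ((cmod (c n))\<^sup>2))"
    using lim by (simp add: suminf_ennreal2 sums_iff)
  finally show ?thesis unfolding F_def .
qed

section \<open>Rotation invariance of planar Lebesgue measure\<close>

lemma borel_measurable_Complex [measurable]:
  assumes "f \<in> borel_measurable M" "g \<in> borel_measurable M"
  shows "(\<lambda>x. Complex (f x) (g x)) \<in> borel_measurable M"
  using assms by (simp add: borel_measurable_complex_iff)

lemma lborel_complex_eq_distr: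
  "(lborel :: complex measure) = distr (lborel \<Otimes>\<^sub>M lborel) borel (\<lambda>(x, y). Complex x y)"
proof (rule lborel_eqI)
  fix l u :: complex
  assume le: "\<And>b. b \<in> Basis \<Longrightarrow> l \<bullet> b \<le> u \<bullet> b"
  have le': "Re l \<le> Re u" "Im l \<le> Im u"
    using le[of 1] le[of \<i>] by (auto simp: Basis_complex_def)
  have "(\<lambda>(x, y). Complex x y) -` box l u \<inter> space (lborel \<Otimes>\<^sub>M lborel)
     = {Re l<..<Re u} \<times> {Im l<..<Im u}"
    by (auto simp: in_box_complex_iff space_pair_measure)
  then show "emeasure (distr (lborel \<Otimes>\<^sub>M lborel) borel (\<lambda>(x, y). Complex x y)) (box l u)
      = ennreal (\<Prod>b\<in>Basis. (u - l) \<bullet> b)"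
    using le' by (simp add: emeasure_distr lborel.emeasure_pair_measure_Times Basis_complex_def
        ennreal_mult[symmetric])
qed simp

lemma nn_integral_complex:
  fixes f :: "complex \<Rightarrow> ennreal"
  assumes [measurable]: "f \<in> borel_measurable borel"
  shows "(\<integral>\<^sup>+ z. f z \<partial>lborel) = (\<integral>\<^sup>+ y. \<integral>\<^sup>+ x. f (Complex x y) \<partial>lborel \<partial>lborel)"
    and "(\<integral>\<^sup>+ z. f z \<partial>lborel) = (\<integral>\<^sup>+ x. \<integral>\<^sup>+ y. f (Complex x y) \<partial>lborel \<partial>lborel)"
proof -
  have *: "(\<integral>\<^sup>+ z. f z \<partial>lborel) = (\<integral>\<^sup>+ p. f (case p of (x, y) \<Rightarrow> Complex x y) \<partial>(lborel \<Otimes>\<^sub>M lborel))"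
    by (subst lborel_complex_eq_distr, subst nn_integral_distr) auto
  show "(\<integral>\<^sup>+ z. f z \<partial>lborel) = (\<integral>\<^sup>+ y. \<integral>\<^sup>+ x. f (Complex x y) \<partial>lborel \<partial>lborel)"
    unfolding * by (subst lborel_pair.nn_integral_snd[symmetric]) auto
  show "(\<integral>\<^sup>+ z. f z \<partial>lborel) = (\<integral>\<^sup>+ x. \<integral>\<^sup>+ y. f (Complex x y) \<partial>lborel \<partial>lborel)"
    unfolding * by (subst lborel.nn_integral_fst[symmetric]) auto
qed

lemma nn_integral_shear:
  fixes f :: "complex \<Rightarrow> ennreal"
  assumes [measurable]: "f \<in> borel_measurable borel"
  shows "(\<integral>\<^sup>+ z. f (Complex (Re z + t * Im z) (Im z)) \<partial>lborel) = (\<integral>\<^sup>+ z. f z \<partial>lborel)"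
    and "(\<integral>\<^sup>+ z. f (Complex (Re z) (Im z + t * Re z)) \<partial>lborel) = (\<integral>\<^sup>+ z. f z \<partial>lborel)"
proof -
  have "(\<integral>\<^sup>+ x. f (Complex (x + t * y) y) \<partial>lborel) = (\<integral>\<^sup>+ x. f (Complex x y) \<partial>lborel)" for y
    using nn_integral_real_affine[of "\<lambda>x. f (Complex x y)" 1 "t * y"] by (simp add: add.commute)
  then show "(\<integral>\<^sup>+ z. f (Complex (Re z + t * Im z) (Im z)) \<partial>lborel) = (\<integral>\<^sup>+ z. f z \<partial>lborel)"
    by (simp add: nn_integral_complex(1))
  have "(\<integral>\<^sup>+ y. f (Complex x (y + t * x)) \<partial>lborel) = (\<integral>\<^sup>+ y. f (Complex x y) \<partial>lborel)" for x
    using nn_integral_real_affine[of "\<lambda>y. f (Complex x y)" 1 "t * x"] by (simp add: add.commute)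
  then show "(\<integral>\<^sup>+ z. f (Complex (Re z) (Im z + t * Re z)) \<partial>lborel) = (\<integral>\<^sup>+ z. f z \<partial>lborel)"
    by (simp add: nn_integral_complex(2))
qed

text \<open>A rotation that is not real is the product of a horizontal, a vertical and again a horizontal
  shear; the rotation by \<open>-1\<close> is the square of the one by \<open>\<i>\<close>.\<close>

lemma nn_integral_rotate:
  fixes f :: "complex \<Rightarrow> ennreal"
  assumes f[measurable]: "f \<in> borel_measurable borel" and c: "cmod c = 1"
  shows "(\<integral>\<^sup>+ z. f (c * z) \<partial>lborel) = (\<integral>\<^sup>+ z. f z \<partial>lborel)"
proof -
  have nonreal: "(\<integral>\<^sup>+ z. g (c * z) \<partial>lborel) = (\<integral>\<^sup>+ z. g z \<partial>lborel)"
    if g[measurable]: "g \<in> borel_measurable borel" and c: "cmod c = 1" "Im c \<noteq> 0"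
    for g :: "complex \<Rightarrow> ennreal" and c
  proof -
    \<comment> \<open>minus the tangent of half the rotation angle\<close>
    define t where "t = (Re c - 1) / Im c"
    have c2: "(Re c)\<^sup>2 + (Im c)\<^sup>2 = 1"
      using c(1) by (simp add: cmod_def)
    have t1: "Im c * t = Re c - 1"
      using c(2) by (simp add: t_def)
    have t2: "t * (Re c + 1) = - Im c"
      using c2 c(2) by (simp add: t_def field_simps power2_eq_square)
    define G where "G z = g (Complex (Re z + t * Im z) (Im z))" for z
    define K where "K z = G (Complex (Re z) (Im z + Im c * Re z))" for z
    have [measurable]: "G \<in> borel_measurable borel" "K \<in> borel_measurable borel"
      unfolding G_def K_def by measurable
    have "g (c * z) = K (Complex (Re z + t * Im z) (Im z))" for z
    proof -
      have im: "Im z + Im c * (Re z + t * Im z) = Im (c * z)"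
        using t1 by (simp only: times_complex.sel) algebra
      have "Re z + t * Im z + t * Im (c * z) = Re z * (1 + t * Im c) + Im z * (t * (Re c + 1))"
        by (simp add: algebra_simps)
      also have "\<dots> = Re (c * z)"
        using t1 t2 by (simp add: algebra_simps)
      finally have re: "Re z + t * Im z + t * Im (c * z) = Re (c * z)" .
      show ?thesis
        unfolding K_def G_def by (simp only: complex.sel im re complex.collapse)
    qed
    then show ?thesis
      using nn_integral_shear(1)[of K t] nn_integral_shear(2)[of G "Im c"] nn_integral_shear(1)[of g t]
      by (simp add: K_def G_def)
  qed
  show ?thesis
  proof (cases "Im c = 0")
    case False
    then show ?thesis using nonreal[OF f c] by simp
  next
    case True
    then have "c = 1 \<or> c = \<i> * \<i>"
      using c by (auto simp: complex_eq_iff cmod_def abs_if split: if_splits)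
    then show ?thesis
    proof
      assume "c = \<i> * \<i>"
      then show ?thesis
        using nonreal[of "\<lambda>z. f (\<i> * z)" \<i>] nonreal[of f \<i>] by (simp add: mult.assoc)
    qed simp
  qed
qed

section \<open>The Dirichlet space in terms of Taylor coefficients\<close>

text \<open>Since the disk of radius \<open>t\<close> has area \<open>\<pi> t\<^sup>2\<close>, writing \<open>1 - \<bar>z\<bar>\<^bsup>2n\<^esup>\<close> as the integral of
  \<open>2 n t\<^bsup>2n-1\<^esup>\<close> over \<open>\<bar>z\<bar> \<le> t \<le> 1\<close> and exchanging integrals avoids polar coordinates.\<close>

lemma nn_integral_disk_power:
  "(\<integral>\<^sup>+ z \<in> ball 0 1. ennreal (cmod z ^ (2 * n)) \<partial>lborel) = ennreal (pi / real (Suc n))"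
proof -
  let ?I = "\<integral>\<^sup>+ z \<in> ball 0 1. ennreal (cmod z ^ (2 * n)) \<partial>lborel"
  define w where "w t = 2 * real n * t ^ (2 * n - 1)" for t :: real
  define J where "J z t = ennreal (w t) * indicator {cmod z..1} t" for z :: complex and t
  have w: "((\<lambda>t. t ^ (2 * n)) has_real_derivative w t) (at t)" for t
    unfolding w_def by (auto intro!: derivative_eq_intros)
  have w0: "0 \<le> w t" if "0 \<le> t" for t
    using that by (simp add: w_def)
  have [measurable]: "w \<in> borel_measurable borel"
    unfolding w_def by measurable
  have [measurable]: "(\<lambda>(z, t). J z t) \<in> borel_measurable (borel \<Otimes>\<^sub>M borel)"
  proof -
    have "(\<lambda>(z, t). J z t) = (\<lambda>p. ennreal (w (snd p)) * (if cmod (fst p) \<le> snd p \<and> snd p \<le> 1 then 1 else 0))"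
      by (auto simp: J_def fun_eq_iff indicator_def)
    then show ?thesis by simp
  qed
  have inner: "(\<integral>\<^sup>+ t. J z t \<partial>lborel) = ennreal (1 - cmod z ^ (2 * n))" if "cmod z < 1" for z
  proof -
    have "(\<integral>\<^sup>+ t. J z t \<partial>lborel) = ennreal (1 ^ (2 * n) - cmod z ^ (2 * n))"
      unfolding J_def using that
      by (intro nn_integral_FTC_Icc[where F="\<lambda>t. t ^ (2 * n)"])
         (auto intro!: w0 intro: order_trans[OF norm_ge_zero] has_field_derivative_at_within w)
    then show ?thesis by simp
  qed
  have vol: "(\<integral>\<^sup>+ z \<in> ball 0 1. J z t \<partial>lborel) = ennreal (pi * 2 * real n * t ^ (2 * n + 1)) * indicator {0..1} t" for t
  proof (cases "t \<in> {0..1}")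
    case True
    have area: "emeasure lborel {z :: complex. cmod z < 1 \<and> cmod z \<le> t} = ennreal (pi * t\<^sup>2)"
    proof (cases "t = 1")
      case True
      then have "{z :: complex. cmod z < 1 \<and> cmod z \<le> t} = ball 0 t" by auto
      then show ?thesis using \<open>t \<in> _\<close> by (simp add: emeasure_ball unit_ball_vol_2)
    next
      case False
      with \<open>t \<in> _\<close> have "{z :: complex. cmod z < 1 \<and> cmod z \<le> t} = cball 0 t" by auto
      then show ?thesis using \<open>t \<in> _\<close> by (simp add: emeasure_cball unit_ball_vol_2)
    qed
    have "(\<integral>\<^sup>+ z \<in> ball 0 1. J z t \<partial>lborel) =
          (\<integral>\<^sup>+ z. ennreal (w t) * indicator {z :: complex. cmod z < 1 \<and> cmod z \<le> t} z \<partial>lborel)"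
      using True by (intro nn_integral_cong) (auto simp: J_def indicator_def)
    also have "\<dots> = ennreal (w t) * ennreal (pi * t\<^sup>2)"
      by (subst nn_integral_cmult_indicator) (auto simp: area)
    also have "\<dots> = ennreal (w t * (pi * t\<^sup>2))"
      using True by (intro ennreal_mult[symmetric]) (auto simp: w0)
    also have "w t * (pi * t\<^sup>2) = pi * 2 * real n * t ^ (2 * n + 1)"
      by (cases n) (simp_all add: w_def power2_eq_square algebra_simps)
    finally show ?thesis using True by simp
  next
    case False
    then have "\<not> (cmod z \<le> t \<and> t \<le> 1)" for z
      using order_trans[OF norm_ge_zero[of z]] by auto
    then have "J z t = 0" for z
      by (auto simp: J_def)
    then show ?thesis using False by simp
  qed
  have [measurable]: "(\<lambda>z. \<integral>\<^sup>+ t. J z t \<partial>lborel) \<in> borel_measurable borel"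
    by (rule lborel.borel_measurable_nn_integral) measurable
  have [measurable]: "ball (0 :: complex) 1 \<in> sets borel"
    by simp
  have "?I + (\<integral>\<^sup>+ z \<in> ball 0 1. (\<integral>\<^sup>+ t. J z t \<partial>lborel) \<partial>lborel)
      = (\<integral>\<^sup>+ z. ennreal (cmod z ^ (2 * n)) * indicator (ball 0 1) z +
          (\<integral>\<^sup>+ t. J z t \<partial>lborel) * indicator (ball 0 1) z \<partial>lborel)"
    by (rule nn_integral_add[symmetric]) measurable
  also have "\<dots> = (\<integral>\<^sup>+ z. indicator (ball 0 1 :: complex set) z \<partial>lborel)"
  proof (rule nn_integral_cong)
    fix z :: complex
    show "ennreal (cmod z ^ (2 * n)) * indicator (ball 0 1) z + (\<integral>\<^sup>+ t. J z t \<partial>lborel) * indicator (ball 0 1) z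
      = indicator (ball 0 1) z"
      by (cases "cmod z < 1") (simp_all add: inner power_le_one flip: ennreal_plus)
  qed
  also have "\<dots> = ennreal pi"
    by (simp add: emeasure_ball unit_ball_vol_2)
  also have "(\<integral>\<^sup>+ z \<in> ball 0 1. (\<integral>\<^sup>+ t. J z t \<partial>lborel) \<partial>lborel)
      = (\<integral>\<^sup>+ z. \<integral>\<^sup>+ t. J z t * indicator (ball 0 1) z \<partial>lborel \<partial>lborel)"
    by (intro nn_integral_cong nn_integral_multc[symmetric]) (simp add: J_def)
  also have "\<dots> = (\<integral>\<^sup>+ t. \<integral>\<^sup>+ z. J z t * indicator (ball 0 1) z \<partial>lborel \<partial>lborel)"
    by (intro lborel_pair.Fubini'[symmetric]) simp
  also have "\<dots> = (\<integral>\<^sup>+ t. ennreal (pi * 2 * real n * t ^ (2 * n + 1)) * indicator {0..1} t \<partial>lborel)"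
    by (simp add: vol)
  also have "\<dots> = ennreal (pi * real n / real (Suc n) * 1 ^ (2 * n + 2) - pi * real n / real (Suc n) * 0 ^ (2 * n + 2))"
  proof (intro nn_integral_FTC_Icc[where F="\<lambda>t. pi * real n / real (Suc n) * t ^ (2 * n + 2)"])
    fix t :: real
    have "pi * real n / real (Suc n) * (real (2 * n + 2) * t ^ (2 * n + 2 - Suc 0)) = pi * 2 * real n * t ^ (2 * n + 1)"
      by (simp add: field_simps)
    then show "((\<lambda>t. pi * real n / real (Suc n) * t ^ (2 * n + 2)) has_real_derivative
        pi * 2 * real n * t ^ (2 * n + 1)) (at t)"
      using DERIV_cmult[OF DERIV_pow[of "2 * n + 2" t UNIV], of "pi * real n / real (Suc n)"] by simp
  qed auto
  finally have "?I + ennreal (pi * real n / real (Suc n)) = ennreal pi"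
    by simp
  then have "?I = ennreal pi - ennreal (pi * real n / real (Suc n))"
    by (metis ennreal_add_diff_cancel_right ennreal_neq_top)
  also have "\<dots> = ennreal (pi / real (Suc n))"
    by (subst ennreal_minus) (auto simp: field_simps intro!: arg_cong[where f=ennreal])
  finally show ?thesis .
qed

text \<open>By rotation invariance the integrand may be replaced by its mean over circles, in which the mixed
  terms of the power series of the derivative disappear.\<close>

lemma dirichlet_norm_sq_power_series:
  assumes f: "\<And>z. cmod z < 1 \<Longrightarrow> (\<lambda>n. c n * z ^ n) sums f z"
  shows "dirichlet_norm_sq f =
    ennreal ((cmod (c 0))\<^sup>2) + (\<Sum>n. ennreal (real (Suc n) * (cmod (c (Suc n)))\<^sup>2))"
proof -
  have hol: "f holomorphic_on ball 0 1"
    by (rule power_series_holomorphic[where a=c]) (use f in auto)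
  define d where "d = diffs c"
  have d: "(\<lambda>n. d n * z ^ n) sums deriv f z" if "cmod z < 1" for z
    unfolding d_def
    by (rule termdiffs_sums_strong[OF f]) (use that hol in \<open>auto intro: holomorphic_derivI\<close>)
  have [measurable]: "ball (0 :: complex) 1 \<in> sets borel"
    by simp
  define G where "G z = ennreal ((cmod (deriv f z))\<^sup>2) * indicator (ball 0 1) z" for z
  have G[measurable]: "G \<in> borel_measurable borel"
  proof -
    have "continuous_on (ball 0 1) (\<lambda>z. (cmod (deriv f z))\<^sup>2)"
      using hol by (intro continuous_intros holomorphic_on_imp_continuous_on holomorphic_deriv) auto
    then have "(\<lambda>z. indicator (ball 0 1) z *\<^sub>R (cmod (deriv f z))\<^sup>2) \<in> borel_measurable borel"
      by (intro borel_measurable_continuous_on_indicator) auto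
    then have "(\<lambda>z. ennreal (indicator (ball 0 1) z *\<^sub>R (cmod (deriv f z))\<^sup>2)) \<in> borel_measurable borel"
      by measurable
    also have "(\<lambda>z. ennreal (indicator (ball 0 1) z *\<^sub>R (cmod (deriv f z))\<^sup>2)) = G"
      by (auto simp: G_def indicator_def)
    finally show ?thesis .
  qed
  interpret prob_space unif by (rule prob_space_unif)
  interpret pair_sigma_finite unif "lborel :: complex measure" ..
  have [measurable]: "cis \<in> borel_measurable borel"
    unfolding cis_conv_exp[abs_def] by (intro borel_measurable_continuous_onI continuous_intros)
  have mean: "(\<integral>\<^sup>+ s. G (cis s * z) \<partial>unif) =
      (\<Sum>n. ennreal ((cmod (d n))\<^sup>2) * (ennreal (cmod z ^ (2 * n)) * indicator (ball 0 1) z))" for z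
  proof (cases "cmod z < 1")
    case True
    then obtain r where r: "cmod z < r" "r < 1" using dense by blast
    have "summable (\<lambda>n. d n * of_real r ^ n)"
      using d[of "of_real r"] r order_trans[OF norm_ge_zero less_imp_le[OF r(1)]] by (simp add: sums_iff)
    then have "summable (\<lambda>n. cmod (d n * z ^ n))"
      by (rule powser_insidea) (use r in simp)
    from circle_mean_sq[OF this]
    have "(\<integral>\<^sup>+ s. ennreal ((cmod (\<Sum>n. d n * z ^ n * cis s ^ n))\<^sup>2) \<partial>unif) =
        (\<Sum>n. ennreal ((cmod (d n * z ^ n))\<^sup>2))" .
    moreover have "G (cis s * z) = ennreal ((cmod (\<Sum>n. d n * z ^ n * cis s ^ n))\<^sup>2)" for s
      using sums_unique[OF d[of "cis s * z"]] True
      by (simp add: G_def norm_mult power_mult_distrib mult_ac)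
    moreover have "ennreal ((cmod (d n * z ^ n))\<^sup>2) = ennreal ((cmod (d n))\<^sup>2) * ennreal (cmod z ^ (2 * n))" for n
      by (simp add: norm_mult norm_power power_mult_distrib power_even_eq flip: ennreal_mult power_mult)
    ultimately show ?thesis using True by simp
  qed (simp add: G_def norm_mult)
  have "(\<integral>\<^sup>+ z. G z \<partial>lborel) = (\<integral>\<^sup>+ s. \<integral>\<^sup>+ z. G (cis s * z) \<partial>lborel \<partial>unif)"
    by (simp add: nn_integral_rotate emeasure_space_1[simplified])
  also have "\<dots> = (\<integral>\<^sup>+ z. \<integral>\<^sup>+ s. G (cis s * z) \<partial>unif \<partial>lborel)"
    by (intro Fubini'[symmetric]) measurable
  also have "\<dots> = (\<Sum>n. \<integral>\<^sup>+ z. ennreal ((cmod (d n))\<^sup>2) * (ennreal (cmod z ^ (2 * n)) * indicator (ball 0 1) z) \<partial>lborel)"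
    unfolding mean by (rule nn_integral_suminf) measurable
  also have "\<dots> = (\<Sum>n. ennreal ((cmod (d n))\<^sup>2) * ennreal (pi / real (Suc n)))"
    by (intro suminf_cong, subst nn_integral_cmult) (simp_all add: nn_integral_disk_power del: of_nat_Suc)
  finally have I: "(\<integral>\<^sup>+ z. G z \<partial>lborel) = \<dots>" .
  have "ennreal (1 / pi) * (\<integral>\<^sup>+ z. G z \<partial>lborel) = (\<Sum>n. ennreal (real (Suc n) * (cmod (c (Suc n)))\<^sup>2))"
    unfolding I ennreal_suminf_cmult[symmetric] d_def diffs_def
    by (intro suminf_cong) (simp add: norm_mult power_mult_distrib power2_eq_square flip: ennreal_mult del: of_nat_Suc)
  moreover have "f 0 = c 0"
    using sums_unique[OF f[of 0]] by simp
  ultimately show ?thesis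
    by (simp add: dirichlet_norm_sq_def G_def)
qed

text \<open>The coefficient sequences are scaled so that the norm for which \<open>dirichlet_kernel\<close> reproduces
  point evaluations becomes the norm of \<open>hseq\<close>.\<close>

definition ev :: "hseq \<Rightarrow> complex \<Rightarrow> complex" where
  "ev a z = (\<Sum>n. hnth a n / of_real (sqrt (real (Suc n))) * z ^ n)"

lemma summable_norm_ev:
  assumes "cmod z < 1"
  shows "summable (\<lambda>n. cmod (hnth a n / of_real (sqrt (real (Suc n))) * z ^ n))"
proof (rule summable_comparison_test')
  show "summable (\<lambda>n. norm a * cmod z ^ n)"
    using assms by (intro summable_mult summable_geometric) simp
  fix n
  have "cmod (hnth a n) / sqrt (real (Suc n)) \<le> norm a / 1"
    by (intro frac_le cmod_hnth_le) auto
  from mult_right_mono[OF this, of "cmod z ^ n"] show "norm (cmod (hnth a n / of_real (sqrt (real (Suc n))) * z ^ n)) \<le> norm a * cmod z ^ n"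
    by (simp add: norm_mult norm_divide norm_power del: of_nat_Suc)
qed

lemma ev_sums:
  assumes "cmod z < 1"
  shows "(\<lambda>n. hnth a n / of_real (sqrt (real (Suc n))) * z ^ n) sums ev a z"
  unfolding ev_def by (intro summable_sums summable_norm_cancel[OF summable_norm_ev] assms)

lemma ev_add: "cmod z < 1 \<Longrightarrow> ev (a + b) z = ev a z + ev b z"
  using sums_add[OF ev_sums[of z a] ev_sums[of z b]]
  by (intro sums_unique2[OF ev_sums]) (simp_all add: algebra_simps add_divide_distrib)

lemma ev_cmul: "cmod z < 1 \<Longrightarrow> ev (cmul c a) z = c * ev a z"
  using sums_mult[OF ev_sums[of z a], of c]
  by (intro sums_unique2[OF ev_sums]) (simp_all add: algebra_simps)

lemma ev_holomorphic: "ev a holomorphic_on ball 0 1"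
  by (rule power_series_holomorphic[where a="\<lambda>n. hnth a n / of_real (sqrt (real (Suc n)))"])
     (use ev_sums in auto)

lemma ev_in_dirichlet_space: "ev a \<in> dirichlet_space"
proof -
  have "dirichlet_norm_sq (ev a) = ennreal ((cmod (hnth a 0))\<^sup>2) +
     (\<Sum>n. ennreal (real (Suc n) * (cmod (hnth a (Suc n) / of_real (sqrt (real (Suc (Suc n))))))\<^sup>2))"
    using dirichlet_norm_sq_power_series[where f="ev a" and c="\<lambda>n. hnth a n / of_real (sqrt (real (Suc n)))", OF ev_sums]
    by (simp only: of_nat_1 real_sqrt_one One_nat_def[symmetric] of_real_1 div_by_1)
  also have "(\<Sum>n. ennreal (real (Suc n) * (cmod (hnth a (Suc n) / of_real (sqrt (real (Suc (Suc n))))))\<^sup>2))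
     \<le> (\<Sum>n. ennreal ((cmod (hnth a (Suc n)))\<^sup>2))"
    by (intro suminf_le summableI)
       (simp add: norm_divide power_divide field_simps mult_left_mono ennreal_leI)
  also have "\<dots> = ennreal (\<Sum>n. (cmod (hnth a (Suc n)))\<^sup>2)"
    by (intro suminf_ennreal2) (auto simp: summable_Suc_iff[of "\<lambda>n. (cmod (hnth a n))\<^sup>2"] summable_hnth)
  finally have "dirichlet_norm_sq (ev a) < \<infinity>"
    by (auto simp: order_le_less_trans)
  then show ?thesis
    by (simp add: dirichlet_space_def ev_holomorphic)
qed

lemma dirichlet_space_evE:
  assumes "f \<in> dirichlet_space"
  obtains a where "\<And>z. cmod z < 1 \<Longrightarrow> f z = ev a z"
proof -
  define c where "c n = (deriv ^^ n) f 0 / fact n" for n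
  have c: "(\<lambda>n. c n * z ^ n) sums f z" if "cmod z < 1" for z
    using holomorphic_power_series[of f 0 1 z] assms that by (simp add: dirichlet_space_def c_def)
  have "dirichlet_norm_sq f = ennreal ((cmod (c 0))\<^sup>2) + (\<Sum>n. ennreal (real (Suc n) * (cmod (c (Suc n)))\<^sup>2))"
    by (rule dirichlet_norm_sq_power_series) (rule c)
  moreover have "dirichlet_norm_sq f < \<infinity>"
    using assms by (simp add: dirichlet_space_def)
  ultimately have "(\<Sum>n. ennreal (real (Suc n) * (cmod (c (Suc n)))\<^sup>2)) < top"
    by (simp del: of_nat_Suc)
  then have 1: "summable (\<lambda>n. real (Suc n) * (cmod (c (Suc n)))\<^sup>2)"
    by (intro summable_suminf_not_top) (auto simp del: of_nat_Suc)
  have "summable (\<lambda>n. (cmod (c (Suc n) * of_real (sqrt (real (Suc (Suc n))))))\<^sup>2)"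
  proof (rule summable_comparison_test')
    show "summable (\<lambda>n. 2 * (real (Suc n) * (cmod (c (Suc n)))\<^sup>2))"
      by (intro summable_mult 1)
    show "norm ((cmod (c (Suc n) * of_real (sqrt (real (Suc (Suc n))))))\<^sup>2) \<le> 2 * (real (Suc n) * (cmod (c (Suc n)))\<^sup>2)" for n
      using mult_right_mono[of "real (Suc (Suc n))" "2 * real (Suc n)" "(cmod (c (Suc n)))\<^sup>2"]
      by (simp add: norm_mult power_mult_distrib algebra_simps)
  qed
  then have "summable (\<lambda>n. (cmod (c n * of_real (sqrt (real (Suc n)))))\<^sup>2)"
    by (subst (asm) summable_Suc_iff)
  then have a: "hnth (Hseq (\<lambda>n. c n * of_real (sqrt (real (Suc n))))) = (\<lambda>n. c n * of_real (sqrt (real (Suc n))))"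
    by (rule hnth_Hseq)
  have nz: "complex_of_real (sqrt (real (Suc n))) \<noteq> 0" for n
    by simp
  have "f z = ev (Hseq (\<lambda>n. c n * of_real (sqrt (real (Suc n))))) z" if "cmod z < 1" for z
    using sums_unique[OF c[OF that]] nz unfolding ev_def a by simp
  then show ?thesis by (rule that)
qed

section \<open>Reproducing kernels\<close>

definition kern :: "complex \<Rightarrow> hseq" where
  "kern z = Hseq (\<lambda>n. cnj z ^ n / of_real (sqrt (real (Suc n))))"

lemma hnth_kern:
  assumes "cmod z < 1"
  shows "hnth (kern z) n = cnj z ^ n / of_real (sqrt (real (Suc n)))"
proof -
  have "summable (\<lambda>n. (cmod (cnj z ^ n / of_real (sqrt (real (Suc n)))))\<^sup>2)"
  proof (rule summable_comparison_test')
    have "cmod z ^ 2 < 1" using assms by (simp add: abs_square_less_1)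
    then show "summable (\<lambda>n. (cmod z ^ 2) ^ n)"
      by (intro summable_geometric) simp
    have "(cmod z ^ 2) ^ n / real (Suc n) \<le> (cmod z ^ 2) ^ n / 1" for n
      by (intro divide_left_mono) auto
    then show "norm ((cmod (cnj z ^ n / of_real (sqrt (real (Suc n)))))\<^sup>2) \<le> (cmod z ^ 2) ^ n" for n
      by (simp add: norm_divide norm_power power_divide mult.commute flip: power_mult del: of_nat_Suc)
  qed
  then show ?thesis by (simp add: kern_def hnth_Hseq)
qed

lemma inner_kern: 
  assumes z: "cmod z < 1"
  shows "a \<bullet> kern z = Re (ev a z)" and "a \<bullet> cmul \<i> (kern z) = Im (ev a z)"
proof -
  have k: "hnth (kern z) n = cnj (z ^ n / of_real (sqrt (real (Suc n))))" for n
    by (simp add: hnth_kern[OF z])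
  have 1: "x \<bullet> cnj y = Re (x * y)" "x \<bullet> (\<i> * cnj y) = Im (x * y)" for x y
    by (simp_all add: inner_complex_def)
  have 2: "x / y * w = x * (w / y)" for x y w :: complex
    by simp
  show "a \<bullet> kern z = Re (ev a z)" "a \<bullet> cmul \<i> (kern z) = Im (ev a z)"
    unfolding inner_hseq_def hnth_cmul k 1
    using sums_Re[OF ev_sums[OF z, of a]] sums_Im[OF ev_sums[OF z, of a]]
    unfolding 2 by (simp_all only: sums_iff)
qed

lemma norm_kern_sq: 
  assumes z: "cmod z < 1"
  shows "(\<lambda>n. cmod z ^ (2 * n) / real (Suc n)) sums (norm (kern z))\<^sup>2"
proof -
  have "(\<lambda>n. (cmod (hnth (kern z) n))\<^sup>2) sums (norm (kern z))\<^sup>2"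
    unfolding norm_hseq_sq by (intro summable_sums summable_hnth)
  moreover have "(cmod (hnth (kern z) n))\<^sup>2 = cmod z ^ (2 * n) / real (Suc n)" for n
    by (simp add: hnth_kern[OF z] norm_divide norm_power power_divide mult.commute flip: power_mult del: of_nat_Suc)
  ultimately show ?thesis by simp
qed

lemma norm_kern_ge_1:
  assumes z: "cmod z < 1"
  shows "1 \<le> norm (kern z)"
  using cmod_hnth_le[of "kern z" 0] by (simp add: hnth_kern[OF z])

text \<open>The logarithm in the closed form of the kernel is evaluated only at positive reals here, so its
  real power series suffices.\<close>

lemma kernel_norm_eq:
  assumes z: "cmod z < 1"
  shows "kernel_norm z = norm (kern z)"
proof -
  have "Re (dirichlet_kernel z z) = (norm (kern z))\<^sup>2"
  proof (cases "z = 0")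
    case True
    have "(\<lambda>n. cmod z ^ (2 * n) / real (Suc n)) sums 1"
    proof -
      have "(\<lambda>n. cmod z ^ (2 * n) / real (Suc n)) = (\<lambda>n. if n = 0 then 1 else 0)"
        using True by (auto simp: fun_eq_iff power_0_left)
      then show ?thesis using sums_single[of 0 "\<lambda>_. 1 :: real"] by (simp only:)
    qed
    then show ?thesis
      using sums_unique2[OF norm_kern_sq[OF z]] True by (simp add: dirichlet_kernel_def)
  next
    case False
    define x where "x = (cmod z)\<^sup>2"
    have x: "0 < x" "x < 1"
      using z False by (auto simp: x_def abs_square_less_1)
    have e: "cnj z * z = of_real x"
      unfolding x_def complex_norm_square by (rule mult.commute)
    have "(\<lambda>n. - ((- (- x)) ^ n) / real n) sums ln (1 + - x)"
      using ln_series'[of "-x"] x by simp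
    then have "(\<lambda>n. x ^ n / real n) sums (- ln (1 - x))"
      using sums_minus by fastforce
    then have "(\<lambda>n. x ^ Suc n / real (Suc n)) sums (- ln (1 - x))"
      by (subst sums_Suc_iff) simp
    from sums_mult[OF this, of "1 / x"] have "(\<lambda>n. x ^ n / real (Suc n)) sums (1 / x * ln (1 / (1 - x)))"
      using x by (simp add: ln_div field_simps)
    moreover have "(\<lambda>n. x ^ n / real (Suc n)) = (\<lambda>n. cmod z ^ (2 * n) / real (Suc n))"
      by (simp add: x_def power_mult)
    ultimately have s: "1 / x * ln (1 / (1 - x)) = (norm (kern z))\<^sup>2"
      using sums_unique2[OF norm_kern_sq[OF z]] by metis
    have "Ln (1 / (1 - complex_of_real x)) = of_real (ln (1 / (1 - x)))"
      using x Ln_of_real[of "1 / (1 - x)"] by simp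
    then have "dirichlet_kernel z z = of_real (1 / x * ln (1 / (1 - x)))"
      using x unfolding dirichlet_kernel_def e by simp
    then show ?thesis
      by (metis Re_complex_of_real s)
  qed
  then show ?thesis by (simp add: kernel_norm_def)
qed

section \<open>Nearly orthonormal systems in a Hilbert space\<close>

text \<open>The Gram matrix of the system differs from the identity by a matrix of Hilbert-Schmidt norm at
  most \<open>1/2\<close>, expressed through finite sections only.\<close>

definition nearly_orthonormal :: "('i \<Rightarrow> 'h::real_inner) \<Rightarrow> 'i set \<Rightarrow> bool" where
  "nearly_orthonormal u J \<longleftrightarrow> (\<forall>i\<in>J. norm (u i) = 1) \<and>
     (\<forall>F. finite F \<longrightarrow> F \<subseteq> J \<longrightarrow> (\<Sum>i\<in>F. \<Sum>j\<in>F - {i}. (u i \<bullet> u j)\<^sup>2) \<le> 1 / 4)"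

text \<open>The mixed terms are estimated by the Cauchy-Schwarz inequality for sums over pairs of indices.\<close>

lemma nearly_orthonormal_norm_sum:
  fixes u :: "'i \<Rightarrow> 'h::real_inner"
  assumes u: "nearly_orthonormal u J" and F: "finite F" "F \<subseteq> J"
  shows "(norm (\<Sum>i\<in>F. c i *\<^sub>R u i))\<^sup>2 \<le> 3 / 2 * (\<Sum>i\<in>F. (c i)\<^sup>2)"
proof -
  define S where "S = (\<Sum>i\<in>F. (c i)\<^sup>2)"
  define P where "P = (SIGMA i:F. F - {i})"
  define X where "X = (\<Sum>(i, j)\<in>P. (c i * c j) * (u i \<bullet> u j))"
  have S0: "0 \<le> S" by (simp add: S_def sum_nonneg)
  have P: "finite P" "P \<subseteq> F \<times> F" using F by (auto simp: P_def)
  have unit: "u i \<bullet> u i = 1" if "i \<in> F" for i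
    using u F that by (auto simp: nearly_orthonormal_def norm_eq_1)
  have "(norm (\<Sum>i\<in>F. c i *\<^sub>R u i))\<^sup>2 = (\<Sum>i\<in>F. \<Sum>j\<in>F. (c i * c j) * (u i \<bullet> u j))"
    unfolding power2_norm_eq_inner inner_sum_left
    by (simp add: inner_sum_right mult.assoc sum_distrib_left mult.left_commute)
  also have "\<dots> = (\<Sum>i\<in>F. (c i)\<^sup>2 + (\<Sum>j\<in>F - {i}. (c i * c j) * (u i \<bullet> u j)))"
  proof (rule sum.cong[OF refl])
    fix i assume "i \<in> F"
    then show "(\<Sum>j\<in>F. (c i * c j) * (u i \<bullet> u j)) = (c i)\<^sup>2 + (\<Sum>j\<in>F - {i}. (c i * c j) * (u i \<bullet> u j))"
      using sum.remove[OF F(1) \<open>i \<in> F\<close>, of "\<lambda>j. (c i * c j) * (u i \<bullet> u j)"] unit[of i]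
      by (simp add: power2_eq_square)
  qed
  also have "\<dots> = S + X"
    unfolding X_def P_def S_def using F by (simp add: sum.distrib sum.Sigma)
  finally have eq: "(norm (\<Sum>i\<in>F. c i *\<^sub>R u i))\<^sup>2 = S + X" .
  have "X\<^sup>2 \<le> (\<Sum>(i, j)\<in>P. (c i * c j)\<^sup>2) * (\<Sum>(i, j)\<in>P. (u i \<bullet> u j)\<^sup>2)"
    unfolding X_def using Cauchy_Schwarz_ineq_sum[of "\<lambda>(i, j). c i * c j" "\<lambda>(i, j). u i \<bullet> u j" P]
    by (simp add: case_prod_beta)
  also have "\<dots> \<le> (S * S) * (1 / 4)"
  proof (rule mult_mono)
    have "(\<Sum>(i, j)\<in>P. (c i * c j)\<^sup>2) \<le> (\<Sum>(i, j)\<in>F \<times> F. (c i * c j)\<^sup>2)"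
      using P F by (intro sum_mono2) auto
    also have "\<dots> = S * S"
      by (simp add: S_def sum_product sum.cartesian_product power_mult_distrib)
    finally show "(\<Sum>(i, j)\<in>P. (c i * c j)\<^sup>2) \<le> S * S" .
    show "(\<Sum>(i, j)\<in>P. (u i \<bullet> u j)\<^sup>2) \<le> 1 / 4"
      using u F unfolding P_def nearly_orthonormal_def by (subst sum.Sigma[symmetric]) auto
  qed (auto simp: S0 intro!: sum_nonneg)
  also have "\<dots> = (S / 2)\<^sup>2" by (simp add: power2_eq_square)
  finally have sq: "X\<^sup>2 \<le> (S / 2)\<^sup>2" .
  have "X \<le> S / 2"
    by (rule power2_le_imp_le[OF sq]) (use S0 in simp)
  then show ?thesis using eq by (simp add: S_def)
qed

text \<open>Bessel's inequality, by duality from the estimate for linear combinations: test \<open>x\<close> against the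
  combination whose coefficients are its own inner products.\<close>

lemma nearly_orthonormal_bessel:
  fixes u :: "'i \<Rightarrow> 'h::real_inner"
  assumes u: "nearly_orthonormal u J" and F: "finite F" "F \<subseteq> J"
  shows "(\<Sum>i\<in>F. (x \<bullet> u i)\<^sup>2) \<le> 3 / 2 * (norm x)\<^sup>2"
proof -
  define S where "S = (\<Sum>i\<in>F. (x \<bullet> u i)\<^sup>2)"
  define g where "g = (\<Sum>i\<in>F. (x \<bullet> u i) *\<^sub>R u i)"
  have S0: "0 \<le> S" by (simp add: S_def sum_nonneg)
  have "S = x \<bullet> g"
    by (simp add: S_def g_def inner_sum_right power2_eq_square)
  then have "S\<^sup>2 \<le> (norm x * norm g)\<^sup>2"
    using S0 norm_cauchy_schwarz[of x g] by (intro power_mono) auto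
  also have "\<dots> \<le> (norm x)\<^sup>2 * (3 / 2 * S)"
    unfolding power_mult_distrib g_def S_def
    by (intro mult_left_mono nearly_orthonormal_norm_sum[OF u F, of "\<lambda>i. x \<bullet> u i"]) simp
  finally have "S * S \<le> (3 / 2 * (norm x)\<^sup>2) * S"
    by (simp add: power2_eq_square mult_ac)
  then show ?thesis
    using S0 by (cases "S = 0") (auto simp: S_def)
qed

lemma nearly_orthonormal_summable:
  fixes u :: "'i \<Rightarrow> 'h::{real_inner,banach}"
  assumes u: "nearly_orthonormal u J"
    and c: "\<And>F. finite F \<Longrightarrow> F \<subseteq> J \<Longrightarrow> (\<Sum>i\<in>F. (c i)\<^sup>2) \<le> S"
  shows "(\<lambda>i. c i *\<^sub>R u i) summable_on J"
proof -
  let ?s = "sum (\<lambda>i. c i *\<^sub>R u i)" and ?q = "sum (\<lambda>i. (c i)\<^sup>2)"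
  have "(\<lambda>i. (c i)\<^sup>2) summable_on J"
    by (rule nonneg_bdd_above_summable_on) (auto intro!: bdd_aboveI2 c)
  then have sup: "((\<lambda>i. (c i)\<^sup>2) has_sum (infsum (\<lambda>i. (c i)\<^sup>2) J)) J"
    by simp
  have "\<exists>P. eventually P (finite_subsets_at_top J) \<and> (\<forall>F1 F2. P F1 \<and> P F2 \<longrightarrow> dist (?s F1) (?s F2) < e)"
    if "e > 0" for e :: real
  proof -
    \<comment> \<open>chosen such that \<open>3 / 2 * d = (e / 4)\<^sup>2\<close>\<close>
    define d where "d = e\<^sup>2 / 24"
    have "d > 0" using that by (simp add: d_def)
    then obtain F0 where F0: "finite F0" "F0 \<subseteq> J" "dist (?q F0) (infsum (\<lambda>i. (c i)\<^sup>2) J) \<le> d"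
      using has_sum_finite_approximation[OF sup] by blast
    have close: "norm (?s F - ?s F0) \<le> e / 4" if F: "finite F" "F \<subseteq> J" "F0 \<subseteq> F" for F
    proof (rule power2_le_imp_le)
      have "?s F - ?s F0 = ?s (F - F0)" "?q F - ?q F0 = ?q (F - F0)"
        using F F0 by (simp_all add: sum_diff)
      moreover have "?q F \<le> infsum (\<lambda>i. (c i)\<^sup>2) J"
        by (rule finite_sum_le_has_sum[OF sup]) (use F in auto)
      then have "?q F - ?q F0 \<le> d"
        using F0(3) by (simp add: dist_real_def)
      ultimately have "(norm (?s F - ?s F0))\<^sup>2 \<le> 3 / 2 * d"
        using nearly_orthonormal_norm_sum[OF u, of "F - F0" c] F by fastforce
      then show "(norm (?s F - ?s F0))\<^sup>2 \<le> (e / 4)\<^sup>2"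
        by (simp add: d_def power_divide)
    qed (use \<open>e > 0\<close> in simp)
    define P where "P F \<longleftrightarrow> finite F \<and> F \<subseteq> J \<and> F0 \<subseteq> F" for F
    have "eventually P (finite_subsets_at_top J)"
      unfolding eventually_finite_subsets_at_top P_def using F0 by blast
    moreover have "dist (?s F1) (?s F2) < e" if "P F1" "P F2" for F1 F2
    proof -
      have "norm (?s F1 - ?s F0) \<le> e / 4" "norm (?s F2 - ?s F0) \<le> e / 4"
        using that unfolding P_def by (blast intro: close)+
      then have "dist (?s F1) (?s F2) \<le> e / 4 + e / 4"
        using dist_triangle2[of "?s F1" "?s F2" "?s F0"] unfolding dist_norm by linarith
      then show ?thesis using \<open>e > 0\<close> by simp
    qed
    ultimately show ?thesis by blast
  qed
  then have "cauchy_filter (filtermap ?s (finite_subsets_at_top J))"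
    by (simp add: cauchy_filter_metric_filtermap)
  moreover have "uniform_space_class.complete (UNIV :: 'h set)"
    by (meson Cauchy_convergent UNIV_I complete_def convergent_def)
  ultimately obtain L where "(?s \<longlongrightarrow> L) (finite_subsets_at_top J)"
    using complete_uniform[where S=UNIV] by (force simp add: filterlim_def)
  then show ?thesis
    using summable_on_def has_sum_def by blast
qed

text \<open>One step of a Neumann series: the off-diagonal part of the Gram matrix has Hilbert-Schmidt norm
  at most \<open>1/2\<close>, so synthesis with the prescribed data reproduces them up to half their size.\<close>

lemma nearly_orthonormal_half_solution:
  fixes u :: "'i \<Rightarrow> 'h::{real_inner,banach}"
  assumes u: "nearly_orthonormal u J"
    and c: "\<And>F. finite F \<Longrightarrow> F \<subseteq> J \<Longrightarrow> (\<Sum>i\<in>F. (c i)\<^sup>2) \<le> S"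
  shows "\<exists>x. (norm x)\<^sup>2 \<le> 3 / 2 * S \<and>
    (\<forall>F. finite F \<longrightarrow> F \<subseteq> J \<longrightarrow> (\<Sum>i\<in>F. (c i - x \<bullet> u i)\<^sup>2) \<le> S / 4)"
proof -
  let ?s = "sum (\<lambda>i. c i *\<^sub>R u i)"
  obtain x where x: "(?s \<longlongrightarrow> x) (finite_subsets_at_top J)"
    using nearly_orthonormal_summable[OF u c] unfolding summable_on_def has_sum_def by blast
  have S0: "0 \<le> S" using c[of "{}"] by simp
  have "(norm x)\<^sup>2 \<le> 3 / 2 * S"
  proof (rule tendsto_upperbound)
    show "((\<lambda>F. (norm (?s F))\<^sup>2) \<longlongrightarrow> (norm x)\<^sup>2) (finite_subsets_at_top J)"
      by (intro tendsto_intros x)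
    have "(norm (?s F))\<^sup>2 \<le> 3 / 2 * S" if "finite F" "F \<subseteq> J" for F
      using nearly_orthonormal_norm_sum[OF u that, of c] c[OF that] by linarith
    then show "\<forall>\<^sub>F F in finite_subsets_at_top J. (norm (?s F))\<^sup>2 \<le> 3 / 2 * S"
      by (intro eventually_finite_subsets_at_top_weakI) auto
  qed simp
  moreover have "(\<Sum>i\<in>F. (c i - x \<bullet> u i)\<^sup>2) \<le> S / 4" if F: "finite F" "F \<subseteq> J" for F
  proof (rule tendsto_upperbound)
    show "((\<lambda>H. \<Sum>i\<in>F. (c i - ?s H \<bullet> u i)\<^sup>2) \<longlongrightarrow> (\<Sum>i\<in>F. (c i - x \<bullet> u i)\<^sup>2)) (finite_subsets_at_top J)"
      by (intro tendsto_intros x)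
    have "(\<Sum>i\<in>F. (c i - ?s H \<bullet> u i)\<^sup>2) \<le> S / 4" if H: "finite H" "H \<subseteq> J" "F \<subseteq> H" for H
    proof -
      have "(c i - ?s H \<bullet> u i)\<^sup>2 \<le> S * (\<Sum>j\<in>H - {i}. (u i \<bullet> u j)\<^sup>2)" if "i \<in> F" for i
      proof -
        have "u i \<bullet> u i = 1"
          using u F that by (auto simp: nearly_orthonormal_def norm_eq_1)
        moreover have "?s H \<bullet> u i = c i * (u i \<bullet> u i) + (\<Sum>j\<in>H - {i}. c j * (u j \<bullet> u i))"
          using H that by (subst sum.remove[of H i]) (auto simp: inner_add_left inner_sum_left)
        ultimately have "(c i - ?s H \<bullet> u i)\<^sup>2 = (\<Sum>j\<in>H - {i}. c j * (u i \<bullet> u j))\<^sup>2"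
          by (simp add: inner_commute)
        also have "\<dots> \<le> (\<Sum>j\<in>H - {i}. (c j)\<^sup>2) * (\<Sum>j\<in>H - {i}. (u i \<bullet> u j)\<^sup>2)"
          by (rule Cauchy_Schwarz_ineq_sum)
        also have "\<dots> \<le> S * (\<Sum>j\<in>H - {i}. (u i \<bullet> u j)\<^sup>2)"
          using H by (intro mult_right_mono c sum_nonneg) auto
        finally show ?thesis .
      qed
      then have "(\<Sum>i\<in>F. (c i - ?s H \<bullet> u i)\<^sup>2) \<le> (\<Sum>i\<in>F. S * (\<Sum>j\<in>H - {i}. (u i \<bullet> u j)\<^sup>2))"
        by (rule sum_mono)
      also have "\<dots> \<le> (\<Sum>i\<in>H. S * (\<Sum>j\<in>H - {i}. (u i \<bullet> u j)\<^sup>2))"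
        using H S0 by (intro sum_mono2) (auto intro!: mult_nonneg_nonneg sum_nonneg)
      also have "\<dots> = S * (\<Sum>i\<in>H. \<Sum>j\<in>H - {i}. (u i \<bullet> u j)\<^sup>2)"
        by (simp add: sum_distrib_left)
      also have "\<dots> \<le> S * (1 / 4)"
        using u H S0 by (intro mult_left_mono) (auto simp: nearly_orthonormal_def)
      finally show ?thesis by simp
    qed
    then show "\<forall>\<^sub>F H in finite_subsets_at_top J. (\<Sum>i\<in>F. (c i - ?s H \<bullet> u i)\<^sup>2) \<le> S / 4"
      unfolding eventually_finite_subsets_at_top using F by blast
  qed simp
  ultimately show ?thesis by blast
qed

text \<open>Iterating the previous step on the remaining errors \<open>R k\<close>, whose square sums are at most \<open>S / 4\<^bsup>k\<^esup>\<close>,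
  gives corrections \<open>x k\<close> that form a convergent series.\<close>

lemma nearly_orthonormal_solution:
  fixes u :: "'i \<Rightarrow> 'h::{real_inner,banach}"
  assumes u: "nearly_orthonormal u J"
    and c: "\<And>F. finite F \<Longrightarrow> F \<subseteq> J \<Longrightarrow> (\<Sum>i\<in>F. (c i)\<^sup>2) \<le> S"
  shows "\<exists>x. \<forall>i\<in>J. x \<bullet> u i = c i"
proof -
  define bounded where "bounded d s \<longleftrightarrow> (\<forall>F. finite F \<longrightarrow> F \<subseteq> J \<longrightarrow> (\<Sum>i\<in>F. (d i)\<^sup>2) \<le> s)" for d :: "'i \<Rightarrow> real" and s
  have S0: "0 \<le> S" using c[of "{}"] by simp
  have "\<exists>x. (norm x)\<^sup>2 \<le> 3 / 2 * s \<and> bounded (\<lambda>i. d i - x \<bullet> u i) (s / 4)" if "bounded d s" for d s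
    using nearly_orthonormal_half_solution[OF u, of d s] that unfolding bounded_def by blast
  then obtain X where X: "\<And>d s. bounded d s \<Longrightarrow> (norm (X d s))\<^sup>2 \<le> 3 / 2 * s"
      "\<And>d s. bounded d s \<Longrightarrow> bounded (\<lambda>i. d i - X d s \<bullet> u i) (s / 4)"
    by metis
  define R where "R = rec_nat c (\<lambda>k d i. d i - X d (S / 4 ^ k) \<bullet> u i)"
  define x where "x k = X (R k) (S / 4 ^ k)" for k
  have R0: "R 0 = c" and RS: "R (Suc k) i = R k i - x k \<bullet> u i" for k i
    by (simp_all add: R_def x_def)
  have bd: "bounded (R k) (S / 4 ^ k)" for k
  proof (induction k)
    case 0
    then show ?case using c by (simp add: R0 bounded_def)
  next
    case (Suc k)
    have "R (Suc k) = (\<lambda>i. R k i - X (R k) (S / 4 ^ k) \<bullet> u i)"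
      by (auto simp: RS x_def)
    then show ?case using X(2)[OF Suc] by (simp add: mult.commute)
  qed
  have "norm (x k) \<le> sqrt (3 / 2 * S) * (1 / 2) ^ k" for k
  proof (rule power2_le_imp_le)
    have "((2::real) ^ k)\<^sup>2 = 4 ^ k"
      by (simp add: power2_eq_square flip: power_mult_distrib)
    then show "(norm (x k))\<^sup>2 \<le> (sqrt (3 / 2 * S) * (1 / 2) ^ k)\<^sup>2"
      using X(1)[OF bd[of k]] S0
      by (simp add: x_def power_mult_distrib power_divide)
  qed (use S0 in simp)
  moreover have "summable (\<lambda>k. sqrt (3 / 2 * S) * (1 / 2) ^ k)"
    by (intro summable_mult summable_geometric) simp
  ultimately have "summable (\<lambda>k. norm (x k))"
    using summable_comparison_test'[of "\<lambda>k. sqrt (3 / 2 * S) * (1 / 2) ^ k" 0 "\<lambda>k. norm (x k)"]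
    by (simp only: real_norm_def abs_norm_cancel)
  then have sums: "x sums (\<Sum>k. x k)"
    by (rule summable_sums[OF summable_norm_cancel])
  have "(\<Sum>k. x k) \<bullet> u i = c i" if i: "i \<in> J" for i
  proof (rule sums_unique2)
    show "(\<lambda>k. x k \<bullet> u i) sums ((\<Sum>k. x k) \<bullet> u i)"
      by (rule bounded_linear.sums[OF bounded_linear_inner_left sums])
    have le: "(R k i)\<^sup>2 \<le> S * (1 / 4) ^ k" for k
      using bd[of k] i unfolding bounded_def by (auto dest!: spec[of _ "{i}"] simp: power_divide)
    have lim: "(\<lambda>k. S * (1 / 4) ^ k) \<longlonglongrightarrow> 0"
      by (rule tendsto_mult_right_zero) (rule LIMSEQ_power_zero, simp)
    have "(\<lambda>k. (R k i)\<^sup>2) \<longlonglongrightarrow> 0"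
      by (rule tendsto_sandwich[OF _ _ tendsto_const lim]) (simp_all only: le zero_le_power2 eventually_True)
    then have "(\<lambda>k. R k i) \<longlonglongrightarrow> 0"
      using tendsto_real_sqrt[of _ 0] by (fastforce simp: tendsto_rabs_zero_iff)
    from telescope_sums'[OF this] show "(\<lambda>k. x k \<bullet> u i) sums c i"
      by (simp add: RS R0)
  qed
  then show ?thesis by blast
qed

section \<open>Interpolation in terms of kernels\<close>

lemma kern_nonzero: "cmod z < 1 \<Longrightarrow> kern z \<noteq> 0"
  using norm_kern_ge_1[of z] by auto

text \<open>Only values at the points of \<open>\<Lambda>\<close> enter the definition, so functions in the space can be
  exchanged for their coefficient sequences and the closed form of the kernel disappears.\<close>

lemma universal_interpolating_iff:
  assumes L: "\<Lambda> \<subseteq> ball 0 1"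
  shows "universal_interpolating \<Lambda> \<longleftrightarrow>
    (\<forall>a. (\<lambda>z. (cmod (ev a z / of_real (norm (kern z))))\<^sup>2) summable_on \<Lambda>) \<and>
    (\<forall>c. (\<lambda>z. (cmod (c z))\<^sup>2) summable_on \<Lambda> \<longrightarrow> (\<exists>a. \<forall>z\<in>\<Lambda>. ev a z = c z * of_real (norm (kern z))))"
    (is "_ \<longleftrightarrow> ?bessel \<and> ?solve")
proof -
  have kn: "kernel_norm z = norm (kern z)" "kern z \<noteq> 0" if "z \<in> \<Lambda>" for z
    using L that kern_nonzero[of z] kernel_norm_eq[of z] by auto
  have R: "restriction_map \<Lambda> (ev a) z = ev a z / of_real (norm (kern z))" if "z \<in> \<Lambda>" for a z
    using that by (simp add: restriction_map_def kn)
  have Rext: "restriction_map \<Lambda> f \<in> extensional \<Lambda>" for f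
    by (simp add: restriction_map_def)
  have ell: "restriction_map \<Lambda> (ev a) \<in> ell2 \<Lambda> \<longleftrightarrow>
      (\<lambda>z. (cmod (ev a z / of_real (norm (kern z))))\<^sup>2) summable_on \<Lambda>" for a
    unfolding ell2_def using Rext by (simp add: R cong: summable_on_cong)
  have D: "\<exists>a. restriction_map \<Lambda> f = restriction_map \<Lambda> (ev a)" if f: "f \<in> dirichlet_space" for f
  proof -
    obtain a where "\<And>z. cmod z < 1 \<Longrightarrow> f z = ev a z" using dirichlet_space_evE[OF f] by blast
    then have "restriction_map \<Lambda> f = restriction_map \<Lambda> (ev a)"
      using L unfolding restriction_map_def by (intro restrict_ext) auto
    then show ?thesis by blast
  qed
  have bessel: "restriction_map \<Lambda> \<in> dirichlet_space \<rightarrow> ell2 \<Lambda> \<longleftrightarrow> ?bessel"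
  proof
    assume "restriction_map \<Lambda> \<in> dirichlet_space \<rightarrow> ell2 \<Lambda>"
    then show ?bessel using ev_in_dirichlet_space ell by blast
  next
    assume ?bessel
    then have "restriction_map \<Lambda> f \<in> ell2 \<Lambda>" if "f \<in> dirichlet_space" for f
      using D[OF that] ell by metis
    then show "restriction_map \<Lambda> \<in> dirichlet_space \<rightarrow> ell2 \<Lambda>" by blast
  qed
  have solve: "ell2 \<Lambda> \<subseteq> restriction_map \<Lambda> ` dirichlet_space \<longleftrightarrow> ?solve"
  proof
    assume sub: "ell2 \<Lambda> \<subseteq> restriction_map \<Lambda> ` dirichlet_space"
    show ?solve
    proof (intro allI impI)
      fix c assume "(\<lambda>z. (cmod (c z))\<^sup>2) summable_on \<Lambda>"
      then have "restrict c \<Lambda> \<in> ell2 \<Lambda>"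
        unfolding ell2_def by (simp cong: summable_on_cong)
      then obtain f where "f \<in> dirichlet_space" "restrict c \<Lambda> = restriction_map \<Lambda> f"
        using sub by blast
      then obtain a where a: "restrict c \<Lambda> = restriction_map \<Lambda> (ev a)" using D by metis
      have "ev a z = c z * of_real (norm (kern z))" if "z \<in> \<Lambda>" for z
        using fun_cong[OF a, of z] R[OF that, of a] kn[OF that] that by simp
      then show "\<exists>a. \<forall>z\<in>\<Lambda>. ev a z = c z * of_real (norm (kern z))" by blast
    qed
  next
    assume ?solve
    show "ell2 \<Lambda> \<subseteq> restriction_map \<Lambda> ` dirichlet_space"
    proof
      fix c assume c: "c \<in> ell2 \<Lambda>"
      then obtain a where a: "\<forall>z\<in>\<Lambda>. ev a z = c z * of_real (norm (kern z))"
        using \<open>?solve\<close> by (auto simp: ell2_def)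
      have "c = restriction_map \<Lambda> (ev a)"
        using c Rext by (intro extensionalityI[of _ \<Lambda>]) (auto simp: ell2_def R a kn)
      then show "c \<in> restriction_map \<Lambda> ` dirichlet_space"
        using ev_in_dirichlet_space by blast
    qed
  qed
  show ?thesis
    unfolding universal_interpolating_def using L bessel solve by blast
qed

text \<open>The squared modulus of an entry of the Gram matrix of the normalised kernels.\<close>

definition gram :: "complex \<Rightarrow> complex \<Rightarrow> real" where
  "gram z w = (cmod (ev (kern z) w))\<^sup>2 / ((norm (kern z))\<^sup>2 * (norm (kern w))\<^sup>2)"

lemma gram_nonneg: "0 \<le> gram z w"
  by (simp add: gram_def)

text \<open>The real Hilbert space structure sees the real and imaginary parts of a point evaluation as two
  orthogonal functionals.\<close>

definition nker :: "complex \<times> bool \<Rightarrow> hseq" where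
  "nker p = (1 / norm (kern (fst p))) *\<^sub>R (if snd p then kern (fst p) else cmul \<i> (kern (fst p)))"

lemma inner_nker:
  assumes "cmod z < 1"
  shows "a \<bullet> nker (z, True) = Re (ev a z) / norm (kern z)"
    and "a \<bullet> nker (z, False) = Im (ev a z) / norm (kern z)"
  using assms by (simp_all add: nker_def inner_kern)

lemma norm_nker: "cmod z < 1 \<Longrightarrow> norm (nker (z, b)) = 1"
  using kern_nonzero[of z] by (simp add: nker_def norm_cmul)

lemma inner_cmul_ii_self: "a \<bullet> cmul \<i> a = 0"
  by (simp add: inner_hseq_def inner_complex_def)

lemma nker_orthogonal:
  assumes "b \<noteq> b'"
  shows "nker (z, b) \<bullet> nker (z, b') = 0"
  using assms inner_cmul_ii_self[of "kern z"] inner_commute[of "kern z" "cmul \<i> (kern z)"]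
  by (cases b; cases b') (simp_all add: nker_def)

lemma sum_inner_nker_sq:
  assumes "cmod z < 1"
  shows "(\<Sum>b\<in>UNIV. (a \<bullet> nker (z, b))\<^sup>2) = (cmod (ev a z / of_real (norm (kern z))))\<^sup>2"
  using norm_kern_ge_1[OF assms]
  by (simp add: UNIV_bool inner_nker[OF assms] norm_divide power_divide cmod_power2 add_divide_distrib)

lemma sum_nker_nker_sq:
  assumes z: "cmod z < 1" and w: "cmod w < 1"
  shows "(\<Sum>b\<in>UNIV. \<Sum>b'\<in>UNIV. (nker (z, b) \<bullet> nker (w, b'))\<^sup>2) = 2 * gram z w"
proof -
  have "ev (nker (z, b)) w = (if b then 1 else \<i>) * of_real (1 / norm (kern z)) * ev (kern z) w" for b
    using w by (simp add: nker_def scaleR_hseq_def ev_cmul)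
  then show ?thesis
    using norm_kern_ge_1[OF z] unfolding sum_inner_nker_sq[OF w]
    by (simp add: UNIV_bool norm_divide norm_mult power_divide power_mult_distrib gram_def)
qed

text \<open>Each complex Gram entry is spread over four real ones whose squares add up to twice \<open>gram z w\<close>;
  hence \<open>1/8\<close> instead of \<open>1/4\<close>.\<close>

lemma nearly_orthonormal_nker:
  assumes T: "T \<subseteq> ball 0 1"
    and small: "\<And>F. finite F \<Longrightarrow> F \<subseteq> T \<Longrightarrow> (\<Sum>z\<in>F. \<Sum>w\<in>F - {z}. gram z w) \<le> 1 / 8"
  shows "nearly_orthonormal nker (T \<times> UNIV)"
  unfolding nearly_orthonormal_def
proof (intro conjI allI impI)
  show "\<forall>p\<in>T \<times> UNIV. norm (nker p) = 1"
    using T norm_nker by auto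
  fix F :: "(complex \<times> bool) set"
  assume F: "finite F" "F \<subseteq> T \<times> UNIV"
  define H where "H = fst ` F"
  have H: "finite H" "H \<subseteq> T" "F \<subseteq> H \<times> UNIV"
    using F by (auto simp: H_def image_iff) force
  have "(\<Sum>p\<in>F. \<Sum>q\<in>F - {p}. (nker p \<bullet> nker q)\<^sup>2) \<le> (\<Sum>p\<in>F. \<Sum>q\<in>H \<times> UNIV - {p}. (nker p \<bullet> nker q)\<^sup>2)"
    using H by (intro sum_mono sum_mono2) auto
  also have "\<dots> \<le> (\<Sum>p\<in>H \<times> UNIV. \<Sum>q\<in>H \<times> UNIV - {p}. (nker p \<bullet> nker q)\<^sup>2)"
    using H by (intro sum_mono2 sum_nonneg) auto
  also have "\<dots> = (\<Sum>z\<in>H. \<Sum>b\<in>UNIV. \<Sum>q\<in>H \<times> UNIV - {(z, b)}. (nker (z, b) \<bullet> nker q)\<^sup>2)"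
    by (simp add: sum.cartesian_product)
  also have "\<dots> = (\<Sum>z\<in>H. \<Sum>b\<in>UNIV. \<Sum>w\<in>H - {z}. \<Sum>b'\<in>UNIV. (nker (z, b) \<bullet> nker (w, b'))\<^sup>2)"
  proof (intro sum.cong refl)
    fix z and b :: bool assume "z \<in> H"
    have "(\<Sum>q\<in>H \<times> UNIV - {(z, b)}. (nker (z, b) \<bullet> nker q)\<^sup>2) = (\<Sum>q\<in>(H - {z}) \<times> UNIV. (nker (z, b) \<bullet> nker q)\<^sup>2)"
    proof (intro sum.mono_neutral_right ballI)
      fix q assume "q \<in> H \<times> UNIV - {(z, b)} - (H - {z}) \<times> UNIV"
      then obtain b' where "q = (z, b')" "b \<noteq> b'" by auto
      then show "(nker (z, b) \<bullet> nker q)\<^sup>2 = 0" by (simp add: nker_orthogonal)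
    qed (use H(1) in auto)
    then show "(\<Sum>q\<in>H \<times> UNIV - {(z, b)}. (nker (z, b) \<bullet> nker q)\<^sup>2) = (\<Sum>w\<in>H - {z}. \<Sum>b'\<in>UNIV. (nker (z, b) \<bullet> nker (w, b'))\<^sup>2)"
      by (simp add: sum.cartesian_product)
  qed
  also have "\<dots> = (\<Sum>z\<in>H. \<Sum>w\<in>H - {z}. \<Sum>b\<in>UNIV. \<Sum>b'\<in>UNIV. (nker (z, b) \<bullet> nker (w, b'))\<^sup>2)"
    by (intro sum.cong refl sum.swap)
  also have "\<dots> = (\<Sum>z\<in>H. \<Sum>w\<in>H - {z}. 2 * gram z w)"
    using H T by (intro sum.cong refl sum_nker_nker_sq) auto
  also have "\<dots> = 2 * (\<Sum>z\<in>H. \<Sum>w\<in>H - {z}. gram z w)"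
    by (simp add: sum_distrib_left)
  also have "\<dots> \<le> 1 / 4"
    using small[OF H(1,2)] by simp
  finally show "(\<Sum>p\<in>F. \<Sum>q\<in>F - {p}. (nker p \<bullet> nker q)\<^sup>2) \<le> 1 / 4" .
qed

lemma universal_interpolating_if_gram_small:
  assumes T: "T \<subseteq> ball 0 1"
    and small: "\<And>F. finite F \<Longrightarrow> F \<subseteq> T \<Longrightarrow> (\<Sum>z\<in>F. \<Sum>w\<in>F - {z}. gram z w) \<le> 1 / 8"
  shows "universal_interpolating T"
  unfolding universal_interpolating_iff[OF T]
proof (intro conjI allI impI)
  have no: "nearly_orthonormal nker (T \<times> UNIV)"
    by (rule nearly_orthonormal_nker[OF T small])
  have disk: "cmod z < 1" if "z \<in> T" for z using T that by auto
  fix a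
  show "(\<lambda>z. (cmod (ev a z / of_real (norm (kern z))))\<^sup>2) summable_on T"
  proof (rule nonneg_bdd_above_summable_on)
    have "(\<Sum>z\<in>F. (cmod (ev a z / of_real (norm (kern z))))\<^sup>2) \<le> 3 / 2 * (norm a)\<^sup>2"
      if F: "finite F" "F \<subseteq> T" for F
    proof -
      have "(\<Sum>z\<in>F. (cmod (ev a z / of_real (norm (kern z))))\<^sup>2) = (\<Sum>z\<in>F. \<Sum>b\<in>UNIV. (a \<bullet> nker (z, b))\<^sup>2)"
        using F disk by (intro sum.cong refl sum_inner_nker_sq[symmetric]) auto
      also have "\<dots> = (\<Sum>p\<in>F \<times> UNIV. (a \<bullet> nker p)\<^sup>2)"
        by (simp add: sum.cartesian_product)
      also have "\<dots> \<le> 3 / 2 * (norm a)\<^sup>2"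
        using F by (intro nearly_orthonormal_bessel[OF no]) auto
      finally show ?thesis .
    qed
    then show "bdd_above (sum (\<lambda>z. (cmod (ev a z / of_real (norm (kern z))))\<^sup>2) ` {F. F \<subseteq> T \<and> finite F})"
      by (intro bdd_aboveI2[of _ _ "3 / 2 * (norm a)\<^sup>2"]) blast
  qed simp
next
  have no: "nearly_orthonormal nker (T \<times> UNIV)"
    by (rule nearly_orthonormal_nker[OF T small])
  fix c :: "complex \<Rightarrow> complex"
  assume c: "(\<lambda>z. (cmod (c z))\<^sup>2) summable_on T"
  define d where "d p = (if snd p then Re (c (fst p)) else Im (c (fst p)))" for p :: "complex \<times> bool"
  have "(\<Sum>p\<in>F. (d p)\<^sup>2) \<le> infsum (\<lambda>z. (cmod (c z))\<^sup>2) T" if F: "finite F" "F \<subseteq> T \<times> UNIV" for F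
  proof -
    define H where "H = fst ` F"
    have H: "finite H" "H \<subseteq> T" "F \<subseteq> H \<times> UNIV"
      using F by (auto simp: H_def image_iff) force
    have "(\<Sum>p\<in>F. (d p)\<^sup>2) \<le> (\<Sum>p\<in>H \<times> UNIV. (d p)\<^sup>2)"
      using H by (intro sum_mono2) auto
    also have "\<dots> = (\<Sum>z\<in>H. \<Sum>b\<in>UNIV. (d (z, b))\<^sup>2)"
      by (simp add: sum.cartesian_product)
    also have "\<dots> = (\<Sum>z\<in>H. (cmod (c z))\<^sup>2)"
      by (simp add: UNIV_bool d_def cmod_power2 add.commute)
    also have "\<dots> \<le> infsum (\<lambda>z. (cmod (c z))\<^sup>2) T"
      using H c by (intro finite_sum_le_infsum) auto
    finally show ?thesis .
  qed
  then obtain a where a: "\<forall>p\<in>T \<times> UNIV. a \<bullet> nker p = d p"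
    using nearly_orthonormal_solution[OF no, of d] by blast
  have "ev a z = c z * of_real (norm (kern z))" if z: "z \<in> T" for z
  proof -
    have dz: "cmod z < 1" using T z by auto
    have "Re (ev a z) / norm (kern z) = Re (c z)" "Im (ev a z) / norm (kern z) = Im (c z)"
      using a z inner_nker[OF dz, of a] by (auto simp: d_def)
    then show ?thesis
      using kern_nonzero[OF dz] by (auto simp: complex_eq_iff nonzero_divide_eq_eq)
  qed
  then show "\<exists>a. \<forall>z\<in>T. ev a z = c z * of_real (norm (kern z))" by blast
qed

section \<open>Multiplying and dividing by linear factors\<close>

definition fshift :: "hseq \<Rightarrow> hseq" where
  "fshift a = Hseq (\<lambda>n. case n of 0 \<Rightarrow> 0 |
     Suc m \<Rightarrow> hnth a m * of_real (sqrt (real (Suc (Suc m))) / sqrt (real (Suc m))))"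

definition bshift :: "hseq \<Rightarrow> hseq" where
  "bshift a = Hseq (\<lambda>n. hnth a (Suc n) * of_real (sqrt (real (Suc n)) / sqrt (real (Suc (Suc n)))))"

lemma hnth_fshift:
  "hnth (fshift a) 0 = 0"
  "hnth (fshift a) (Suc m) = hnth a m * of_real (sqrt (real (Suc (Suc m))) / sqrt (real (Suc m)))"
proof -
  let ?b = "\<lambda>n. case n of 0 \<Rightarrow> 0 |
     Suc m \<Rightarrow> hnth a m * of_real (sqrt (real (Suc (Suc m))) / sqrt (real (Suc m)))"
  have le: "(cmod (?b (Suc m)))\<^sup>2 \<le> 2 * (cmod (hnth a m))\<^sup>2" for m
  proof -
    have "(cmod (?b (Suc m)))\<^sup>2 = (cmod (hnth a m))\<^sup>2 * (real (Suc (Suc m)) / real (Suc m))"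
      by (simp add: norm_mult norm_divide power_mult_distrib power_divide del: of_nat_Suc)
    also have "\<dots> \<le> (cmod (hnth a m))\<^sup>2 * 2"
      by (intro mult_left_mono) (auto simp: field_simps)
    finally show ?thesis by simp
  qed
  have "summable (\<lambda>m. (cmod (?b (Suc m)))\<^sup>2)"
    by (rule summable_comparison_test'[OF summable_mult[OF summable_hnth[of a], of 2]])
       (simp only: real_norm_def abs_power2 abs_norm_cancel power_abs le)
  then have "summable (\<lambda>n. (cmod (?b n))\<^sup>2)"
    by (subst (asm) summable_Suc_iff)
  then have "hnth (fshift a) = ?b"
    unfolding fshift_def by (rule hnth_Hseq)
  then show "hnth (fshift a) 0 = 0"
    "hnth (fshift a) (Suc m) = hnth a m * of_real (sqrt (real (Suc (Suc m))) / sqrt (real (Suc m)))"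
    by simp_all
qed

lemma cmod_bshift_le:
  "cmod (hnth a (Suc n) * of_real (sqrt (real (Suc n)) / sqrt (real (Suc (Suc n))))) \<le> cmod (hnth a (Suc n))"
proof -
  have "sqrt (real (Suc n)) / sqrt (real (Suc (Suc n))) \<le> 1"
    by simp
  then have "cmod (hnth a (Suc n)) * (sqrt (real (Suc n)) / sqrt (real (Suc (Suc n)))) \<le> cmod (hnth a (Suc n)) * 1"
    by (intro mult_left_mono) auto
  then show ?thesis
    by (simp add: norm_mult norm_divide del: of_nat_Suc)
qed

lemma hnth_bshift:
  "hnth (bshift a) n = hnth a (Suc n) * of_real (sqrt (real (Suc n)) / sqrt (real (Suc (Suc n))))"
proof -
  have "summable (\<lambda>n. (cmod (hnth a (Suc n)))\<^sup>2)"
    using summable_hnth[of a] by (subst summable_Suc_iff)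
  then have "summable (\<lambda>n. (cmod (hnth a (Suc n) * of_real (sqrt (real (Suc n)) / sqrt (real (Suc (Suc n))))))\<^sup>2)"
    by (rule summable_comparison_test') (simp only: real_norm_def abs_power2 power_abs abs_norm_cancel power_mono[OF cmod_bshift_le norm_ge_zero])
  then show ?thesis
    by (simp add: bshift_def hnth_Hseq)
qed

lemma norm_bshift_le: "norm (bshift a) \<le> norm a"
proof (rule norm_hseq_leI)
  fix k
  have "(\<Sum>n<k. (cmod (hnth (bshift a) n))\<^sup>2) \<le> (\<Sum>n<k. (cmod (hnth a (Suc n)))\<^sup>2)"
    unfolding hnth_bshift by (intro sum_mono power_mono cmod_bshift_le) auto
  also have "\<dots> \<le> (\<Sum>n<Suc k. (cmod (hnth a n))\<^sup>2)"
    by (subst sum.lessThan_Suc_shift) simp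
  also have "\<dots> \<le> (norm a)\<^sup>2"
    by (rule sum_sq_hnth_le)
  finally show "(\<Sum>n<k. (cmod (hnth (bshift a) n))\<^sup>2) \<le> (norm a)\<^sup>2" .
qed simp

lemma ev_fshift:
  assumes z: "cmod z < 1"
  shows "ev (fshift a) z = z * ev a z"
proof -
  let ?c = "\<lambda>n. hnth (fshift a) n / of_real (sqrt (real (Suc n))) * z ^ n"
  have "(\<lambda>n. z * (hnth a n / of_real (sqrt (real (Suc n))) * z ^ n)) sums (z * ev a z)"
    by (intro sums_mult ev_sums z)
  moreover have "?c (Suc n) = z * (hnth a n / of_real (sqrt (real (Suc n))) * z ^ n)" for n
    by (simp add: hnth_fshift field_simps del: of_nat_Suc)
  ultimately have "(\<lambda>n. ?c (Suc n)) sums (z * ev a z)"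
    by simp
  then have "?c sums (z * ev a z)"
    by (subst (asm) sums_Suc_iff) (simp add: hnth_fshift)
  then show ?thesis
    by (rule sums_unique2[OF ev_sums[OF z]])
qed

lemma ev_bshift:
  assumes z: "cmod z < 1"
  shows "z * ev (bshift a) z = ev a z - hnth a 0"
proof -
  let ?c = "\<lambda>n. hnth a n / of_real (sqrt (real (Suc n))) * z ^ n"
  have "(\<lambda>n. z * (hnth (bshift a) n / of_real (sqrt (real (Suc n))) * z ^ n)) sums (z * ev (bshift a) z)"
    by (intro sums_mult ev_sums z)
  moreover have "z * (hnth (bshift a) n / of_real (sqrt (real (Suc n))) * z ^ n) = ?c (Suc n)" for n
    by (simp add: hnth_bshift field_simps del: of_nat_Suc)
  ultimately have "(\<lambda>n. ?c (Suc n)) sums (z * ev (bshift a) z)"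
    by simp
  moreover have "(\<lambda>n. ?c (Suc n)) sums (ev a z - ?c 0)"
    using ev_sums[OF z, of a] by (subst sums_Suc_iff) simp
  ultimately show ?thesis
    by (simp add: sums_unique2)
qed

text \<open>Dividing by \<open>z - \<mu>\<close> amounts to solving \<open>b = bshift (a + \<mu> b)\<close>, and the backward shift is a
  contraction.\<close>

lemma divide_linear_factor:
  assumes \<mu>: "cmod \<mu> < 1"
  shows "\<exists>b. \<forall>z. cmod z < 1 \<longrightarrow> (z - \<mu>) * ev b z = ev a z - ev a \<mu>"
proof -
  have diff: "bshift x - bshift y = bshift (x - y)" for x y
    by (intro hseq_eqI) (simp add: hnth_bshift algebra_simps diff_divide_distrib)
  have "\<exists>!b. bshift (a + cmul \<mu> b) = b"
  proof (rule banach_fix_type[of "cmod \<mu>"])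
    have "a + cmul \<mu> x - (a + cmul \<mu> y) = cmul \<mu> (x - y)" for x y
      by (intro hseq_eqI) (simp add: algebra_simps)
    then have "dist (bshift (a + cmul \<mu> x)) (bshift (a + cmul \<mu> y)) \<le> cmod \<mu> * dist x y" for x y
      using norm_bshift_le[of "cmul \<mu> (x - y)"] by (simp only: dist_norm diff norm_cmul)
    then show "\<forall>x y. dist (bshift (a + cmul \<mu> x)) (bshift (a + cmul \<mu> y)) \<le> cmod \<mu> * dist x y" by blast
  qed (use \<mu> in auto)
  then obtain b where b: "bshift (a + cmul \<mu> b) = b" by blast
  define C where "C = hnth (a + cmul \<mu> b) 0"
  have e: "(z - \<mu>) * ev b z = ev a z - C" if z: "cmod z < 1" for z
    using ev_bshift[OF z, of "a + cmul \<mu> b"]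
    unfolding b C_def[symmetric] by (simp add: ev_add[OF z] ev_cmul[OF z] algebra_simps)
  have "C = ev a \<mu>"
    using e[OF \<mu>] by simp
  then show ?thesis using e by blast
qed

lemma multiply_linear_factor:
  assumes "cmod z < 1"
  shows "ev (fshift a + cmul (- \<mu>) a) z = (z - \<mu>) * ev a z"
  using assms by (simp add: ev_add ev_cmul ev_fshift algebra_simps)

lemma isCont_ev:
  assumes "cmod z < 1"
  shows "isCont (ev a) z"
  using continuous_on_eq_continuous_at[OF open_ball, of 0 1 "ev a"] assms
  by (simp add: holomorphic_on_imp_continuous_on ev_holomorphic)

text \<open>If every function vanishing on \<open>\<Lambda>\<close> also vanished at \<open>\<mu>\<close>, then \<open>z - \<mu>\<close> could be divided out
  indefinitely, against the finite order of the zero of \<open>ev a\<close> at \<open>\<mu>\<close>.\<close>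

lemma zero_free_at_new_point:
  assumes L: "\<Lambda> \<subseteq> ball 0 1" and \<mu>: "\<mu> \<in> ball 0 1" "\<mu> \<notin> \<Lambda>"
    and a: "\<And>z. z \<in> \<Lambda> \<Longrightarrow> ev a z = 0" and z0: "z0 \<in> ball 0 1" "ev a z0 \<noteq> 0"
  shows "\<exists>b. (\<forall>z\<in>\<Lambda>. ev b z = 0) \<and> ev b \<mu> \<noteq> 0"
proof (rule ccontr)
  assume no: "\<not> ?thesis"
  have \<mu>1: "cmod \<mu> < 1" using \<mu> by simp
  have div: "\<exists>b. (\<forall>z\<in>\<Lambda>. ev b z = 0) \<and> (\<forall>z. cmod z < 1 \<longrightarrow> ev a z = (z - \<mu>) ^ m * ev b z)" for m
  proof (induction m)
    case 0
    then show ?case using a by (intro exI[of _ a]) auto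
  next
    case (Suc m)
    then obtain b where b: "\<forall>z\<in>\<Lambda>. ev b z = 0" "\<And>z. cmod z < 1 \<Longrightarrow> ev a z = (z - \<mu>) ^ m * ev b z" by blast
    have "ev b \<mu> = 0" using no b(1) by blast
    then obtain d where d: "\<And>z. cmod z < 1 \<Longrightarrow> (z - \<mu>) * ev d z = ev b z"
      using divide_linear_factor[OF \<mu>1, of b] by auto
    have "ev d z = 0" if "z \<in> \<Lambda>" for z
    proof -
      have "cmod z < 1" "z \<noteq> \<mu>" using that L \<mu> by auto
      then show ?thesis using d[of z] b(1) that by auto
    qed
    moreover have "ev a z = (z - \<mu>) ^ Suc m * ev d z" if "cmod z < 1" for z
      by (simp only: b(2)[OF that] d[OF that, symmetric] power_Suc mult_ac)
    ultimately show ?case by blast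
  qed
  have "ev a \<mu> = 0" using no a by blast
  moreover have "\<not> ev a constant_on ball 0 1"
    using z0 \<open>ev a \<mu> = 0\<close> \<mu> unfolding constant_on_def by metis
  ultimately obtain g r n where g: "0 < r" "ball \<mu> r \<subseteq> ball 0 1" "g holomorphic_on ball \<mu> r"
      "\<And>w. w \<in> ball \<mu> r \<Longrightarrow> ev a w = (w - \<mu>) ^ n * g w" "\<And>w. w \<in> ball \<mu> r \<Longrightarrow> g w \<noteq> 0"
    using holomorphic_factor_zero_nonconstant[OF ev_holomorphic[of a] open_ball connected_ball \<mu>(1)] by metis
  obtain b where b: "\<And>z. cmod z < 1 \<Longrightarrow> ev a z = (z - \<mu>) ^ Suc n * ev b z"
    using div[of "Suc n"] by blast
  have eq: "g w = (w - \<mu>) * ev b w" if "w \<in> ball \<mu> r - {\<mu>}" for w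
  proof -
    have "(w - \<mu>) ^ n * g w = (w - \<mu>) ^ n * ((w - \<mu>) * ev b w)"
      using g(4)[of w] b[of w] g(2) that by (auto simp: mult_ac subset_iff)
    then show ?thesis using that by auto
  qed
  have "isCont g \<mu>"
    using continuous_on_eq_continuous_at[OF open_ball, of \<mu> r g] g(1,3)
    by (simp add: holomorphic_on_imp_continuous_on)
  then have "(g \<longlongrightarrow> g \<mu>) (at \<mu>)" by (simp add: isCont_def)
  moreover have "isCont (\<lambda>w. (w - \<mu>) * ev b w) \<mu>"
  proof -
    have "isCont (ev b) \<mu>"
      by (rule isCont_ev[OF \<mu>1])
    then show ?thesis by (intro continuous_intros)
  qed
  then have "((\<lambda>w. (w - \<mu>) * ev b w) \<longlongrightarrow> 0) (at \<mu>)"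
    by (simp add: isCont_def)
  then have "(g \<longlongrightarrow> 0) (at \<mu>)"
    by (rule Lim_transform_within_open[of _ _ _ _ "ball \<mu> r"]) (use g(1) eq in auto)
  ultimately have "g \<mu> = 0"
    by (intro tendsto_unique[of "at \<mu>"]) auto
  then show False using g(1,5) by auto
qed

lemma zero_sequence_ev:
  assumes "zero_sequence \<Lambda>"
  obtains a z0 where "\<And>z. z \<in> \<Lambda> \<Longrightarrow> ev a z = 0" "z0 \<in> ball 0 1" "ev a z0 \<noteq> 0"
proof -
  obtain f z0 where f: "f \<in> dirichlet_space" "z0 \<in> ball 0 1" "f z0 \<noteq> 0" "\<forall>x\<in>\<Lambda>. f x = 0"
      and L: "\<Lambda> \<subseteq> ball 0 1"
    using assms by (auto simp: zero_sequence_def)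
  obtain a where "\<And>z. cmod z < 1 \<Longrightarrow> f z = ev a z"
    using dirichlet_space_evE[OF f(1)] by blast
  then show ?thesis
    using f L by (intro that[of a z0]) (auto simp: subset_iff)
qed

text \<open>A function interpolating \<open>1\<close> at one point of \<open>\<Lambda>\<close> and \<open>0\<close> at the others, multiplied by one
  linear factor, vanishes on all of \<open>\<Lambda>\<close>.\<close>

lemma universal_interpolating_imp_zero_sequence:
  assumes UI: "universal_interpolating \<Lambda>"
  shows "zero_sequence \<Lambda>"
proof -
  have L: "\<Lambda> \<subseteq> ball 0 1" using UI by (simp add: universal_interpolating_def)
  have k0: "cmod 0 < 1" by simp
  have k: "ev (kern 0) 0 \<noteq> 0"
    using inner_kern(1)[OF k0, of "kern 0"] kern_nonzero[OF k0] by (auto simp flip: power2_norm_eq_inner)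
  have "\<exists>a. (\<forall>z\<in>\<Lambda>. ev a z = 0) \<and> (\<exists>z0\<in>ball 0 1. ev a z0 \<noteq> 0)"
  proof (cases "\<Lambda> = {}")
    case True
    then show ?thesis using k by (intro exI[of _ "kern 0"]) auto
  next
    case False
    then obtain l where l: "l \<in> \<Lambda>" by blast
    define c where "c z = (if z = l then 1 else 0 :: complex)" for z
    have "(\<lambda>z. (cmod (c z))\<^sup>2) summable_on \<Lambda>"
      using summable_on_cong_neutral[of "{l}" \<Lambda> "\<lambda>z. (cmod (c z))\<^sup>2" "\<lambda>z. (cmod (c z))\<^sup>2"] l
      by (simp add: c_def)
    then obtain a where a: "\<forall>z\<in>\<Lambda>. ev a z = c z * of_real (norm (kern z))"
      using UI unfolding universal_interpolating_iff[OF L] by blast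
    have l1: "cmod l < 1" using l L by auto
    have al: "ev a l \<noteq> 0" using a l kern_nonzero[OF l1] by (simp add: c_def)
    have "isCont (ev a) l"
      by (rule isCont_ev[OF l1])
    then have "eventually (\<lambda>z. ev a z \<noteq> 0) (at l)"
      using al by (auto simp: isCont_def dest: tendsto_imp_eventually_ne)
    moreover have "eventually (\<lambda>z. z \<in> ball 0 1 - {l}) (at l)"
      using l L by (intro eventually_at_in_open) auto
    ultimately have "eventually (\<lambda>z. z \<in> ball 0 1 \<and> z \<noteq> l \<and> ev a z \<noteq> 0) (at l)"
      by eventually_elim auto
    from eventually_happens'[OF at_neq_bot this]
    obtain z0 where z0: "z0 \<in> ball 0 1" "z0 \<noteq> l" "ev a z0 \<noteq> 0"
      by blast
    define b where "b = fshift a + cmul (- l) a"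
    have "ev b z = (z - l) * ev a z" if "cmod z < 1" for z
      unfolding b_def by (rule multiply_linear_factor[OF that])
    then have "\<forall>z\<in>\<Lambda>. ev b z = 0" "ev b z0 \<noteq> 0"
      using a L z0 by (auto simp: c_def subset_iff)
    then show ?thesis using z0 by blast
  qed
  then show ?thesis
    using L ev_in_dirichlet_space unfolding zero_sequence_def by blast
qed

text \<open>The value at the new point is corrected by a multiple of a function \<open>g\<close> that vanishes on \<open>\<Lambda>\<close> but not
  at \<open>\<mu>\<close>.\<close>

lemma universal_interpolating_insert:
  assumes UI: "universal_interpolating \<Lambda>" and \<mu>: "\<mu> \<in> ball 0 1"
  shows "universal_interpolating (insert \<mu> \<Lambda>)"
proof (cases "\<mu> \<in> \<Lambda>")
  case True
  then show ?thesis using UI by (simp add: insert_absorb)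
next
  case False
  have L: "\<Lambda> \<subseteq> ball 0 1" using UI by (simp add: universal_interpolating_def)
  then have L': "insert \<mu> \<Lambda> \<subseteq> ball 0 1" using \<mu> by simp
  have \<mu>1: "cmod \<mu> < 1" using \<mu> by simp
  obtain a0 z0 where "\<And>z. z \<in> \<Lambda> \<Longrightarrow> ev a0 z = 0" "z0 \<in> ball 0 1" "ev a0 z0 \<noteq> 0"
    using zero_sequence_ev[OF universal_interpolating_imp_zero_sequence[OF UI]] by blast
  then obtain g where g: "\<forall>z\<in>\<Lambda>. ev g z = 0" "ev g \<mu> \<noteq> 0"
    using zero_free_at_new_point[OF L \<mu> False] by blast
  show ?thesis
    unfolding universal_interpolating_iff[OF L']
  proof (intro conjI allI impI)
    fix a
    show "(\<lambda>z. (cmod (ev a z / of_real (norm (kern z))))\<^sup>2) summable_on insert \<mu> \<Lambda>"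
      using UI unfolding universal_interpolating_iff[OF L] by (simp add: summable_on_insert_iff)
  next
    fix c :: "complex \<Rightarrow> complex"
    assume "(\<lambda>z. (cmod (c z))\<^sup>2) summable_on insert \<mu> \<Lambda>"
    then obtain a where a: "\<forall>z\<in>\<Lambda>. ev a z = c z * of_real (norm (kern z))"
      using UI unfolding universal_interpolating_iff[OF L] by (auto simp: summable_on_insert_iff)
    define t where "t = (c \<mu> * of_real (norm (kern \<mu>)) - ev a \<mu>) / ev g \<mu>"
    have e: "ev (a + cmul t g) z = ev a z + t * ev g z" if "cmod z < 1" for z
      using that by (simp add: ev_add ev_cmul)
    have "ev (a + cmul t g) z = c z * of_real (norm (kern z))" if "z \<in> insert \<mu> \<Lambda>" for z
    proof (cases "z = \<mu>")
      case True
      then show ?thesis using e[OF \<mu>1] g(2) by (simp add: t_def)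
    next
      case False
      then have "z \<in> \<Lambda>" "cmod z < 1" using that L by auto
      then show ?thesis using e a g(1) by simp
    qed
    then show "\<exists>a. \<forall>z\<in>insert \<mu> \<Lambda>. ev a z = c z * of_real (norm (kern z))" by blast
  qed
qed

lemma universal_interpolating_Un_finite:
  assumes "finite F" "F \<subseteq> ball 0 1" "universal_interpolating \<Lambda>"
  shows "universal_interpolating (F \<union> \<Lambda>)"
  using assms by (induction F) (auto intro: universal_interpolating_insert)

section \<open>Kernels at a random angle\<close>

lemma borel_measurable_ev_rcis:
  assumes "0 \<le> r" "r < 1"
  shows "(\<lambda>s. ev a (rcis r s)) \<in> borel_measurable borel"
proof (rule borel_measurable_continuous_onI, rule continuous_on_compose2[of "ball 0 1" "ev a"])
  show "continuous_on (ball 0 1) (ev a)"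
    by (intro holomorphic_on_imp_continuous_on ev_holomorphic)
  show "continuous_on UNIV (rcis r)"
    unfolding rcis_def cis_conv_exp by (intro continuous_intros)
qed (use assms in auto)

lemma norm_kern_rcis:
  assumes "0 \<le> r" "r < 1"
  shows "norm (kern (rcis r s)) = norm (kern (of_real r))"
proof -
  have "(norm (kern (rcis r s)))\<^sup>2 = (norm (kern (of_real r)))\<^sup>2"
    using norm_kern_sq[of "rcis r s"] norm_kern_sq[of "of_real r"] assms
    by (intro sums_unique2[of "\<lambda>n. cmod (of_real r) ^ (2 * n) / real (Suc n)"]) simp_all
  then show ?thesis by simp
qed

lemma circle_mean_ev:
  assumes r: "0 \<le> r" "r < 1"
  shows "(\<integral>\<^sup>+ s. ennreal ((cmod (ev a (rcis r s)))\<^sup>2) \<partial>unif) =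
    (\<Sum>n. ennreal ((cmod (hnth a n))\<^sup>2 / real (Suc n) * r ^ (2 * n)))"
proof -
  let ?c = "\<lambda>n. hnth a n / of_real (sqrt (real (Suc n))) * of_real r ^ n"
  have "summable (\<lambda>n. cmod (?c n))"
    using r by (intro summable_norm_ev) simp
  from circle_mean_sq[OF this]
  have "(\<integral>\<^sup>+ s. ennreal ((cmod (\<Sum>n. ?c n * cis s ^ n))\<^sup>2) \<partial>unif) = (\<Sum>n. ennreal ((cmod (?c n))\<^sup>2))" .
  moreover have "ev a (rcis r s) = (\<Sum>n. ?c n * cis s ^ n)" for s
    by (simp add: ev_def rcis_def power_mult_distrib mult.assoc del: of_nat_Suc)
  moreover have "(cmod (?c n))\<^sup>2 = (cmod (hnth a n))\<^sup>2 / real (Suc n) * r ^ (2 * n)" for n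
    using r by (simp add: norm_mult norm_divide norm_power power_mult_distrib power_divide mult.commute
        flip: power_mult del: of_nat_Suc)
  ultimately show ?thesis by simp
qed

lemma ev_kern_sums:
  assumes "cmod z < 1" "cmod w < 1"
  shows "(\<lambda>n. (cnj z * w) ^ n / of_nat (Suc n)) sums ev (kern z) w"
proof -
  have "hnth (kern z) n / of_real (sqrt (real (Suc n))) * w ^ n = (cnj z * w) ^ n / of_nat (Suc n)" for n
  proof -
    have "complex_of_real (sqrt (real (Suc n))) * complex_of_real (sqrt (real (Suc n))) = of_nat (Suc n)"
      by (simp flip: of_real_mult del: of_nat_Suc)
    then show ?thesis
      using assms by (simp add: hnth_kern power_mult_distrib del: of_nat_Suc)
  qed
  then show ?thesis
    using ev_sums[OF assms(2), of "kern z"] by simp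
qed

lemma gram_sym:
  assumes "cmod z < 1" "cmod w < 1"
  shows "gram z w = gram w z"
proof -
  have "(\<lambda>n. cnj ((cnj w * z) ^ n / of_nat (Suc n))) sums cnj (ev (kern w) z)"
    unfolding sums_cnj by (rule ev_kern_sums) (use assms in auto)
  then have "(\<lambda>n. (cnj z * w) ^ n / of_nat (Suc n)) sums cnj (ev (kern w) z)"
    by (simp add: mult.commute del: of_nat_Suc)
  then have "ev (kern z) w = cnj (ev (kern w) z)"
    by (rule sums_unique2[OF ev_kern_sums[OF assms]])
  then show ?thesis by (simp add: gram_def mult.commute)
qed

text \<open>Comparable to \<open>1 / ln (e / (1 - r))\<close>.\<close>

definition kweight :: "real \<Rightarrow> real" where
  "kweight r = 1 / (norm (kern (of_real r)))\<^sup>2"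

lemma kweight_pos: "0 \<le> r \<Longrightarrow> r < 1 \<Longrightarrow> 0 < kweight r"
  using kern_nonzero[of "of_real r"] by (simp add: kweight_def)

definition inv_sq_sum :: real where
  "inv_sq_sum = (\<Sum>n. 1 / (real (Suc n))\<^sup>2)"

lemma summable_inv_sq: "summable (\<lambda>n. 1 / (real (Suc n))\<^sup>2)"
  using inverse_power_summable[of 2, where 'a=real] summable_Suc_iff[of "\<lambda>n. inverse ((real n)\<^sup>2)"]
  by (simp add: divide_inverse del: of_nat_Suc)

lemma inv_sq_sum_nonneg: "0 \<le> inv_sq_sum"
  unfolding inv_sq_sum_def by (intro suminf_nonneg summable_inv_sq) simp

text \<open>Normalised kernels at independent points are nearly orthogonal on average, because the kernel
  itself has a bounded mean square on every circle.\<close>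

lemma circle_mean_gram_le:
  assumes z: "cmod z < 1" and r: "0 \<le> r" "r < 1"
  shows "(\<integral>\<^sup>+ s. ennreal (gram z (rcis r s)) \<partial>unif) \<le> ennreal (inv_sq_sum * (1 / (norm (kern z))\<^sup>2 * kweight r))"
proof -
  define k where "k = 1 / (norm (kern z))\<^sup>2 * kweight r"
  have k0: "0 \<le> k" by (simp add: k_def kweight_def)
  have [measurable]: "(\<lambda>s. ev (kern z) (rcis r s)) \<in> borel_measurable borel"
    by (rule borel_measurable_ev_rcis[OF r])
  have "gram z (rcis r s) = k * (cmod (ev (kern z) (rcis r s)))\<^sup>2" for s
    by (simp add: gram_def k_def kweight_def norm_kern_rcis[OF r])
  then have "(\<integral>\<^sup>+ s. ennreal (gram z (rcis r s)) \<partial>unif) =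
      ennreal k * (\<integral>\<^sup>+ s. ennreal ((cmod (ev (kern z) (rcis r s)))\<^sup>2) \<partial>unif)"
    by (simp add: ennreal_mult k0 nn_integral_cmult)
  also have "(\<integral>\<^sup>+ s. ennreal ((cmod (ev (kern z) (rcis r s)))\<^sup>2) \<partial>unif) \<le> (\<Sum>n. ennreal (1 / (real (Suc n))\<^sup>2))"
    unfolding circle_mean_ev[OF r]
  proof (intro suminf_le summableI ennreal_leI)
    fix n
    have "(cmod (hnth (kern z) n))\<^sup>2 = cmod z ^ (2 * n) / real (Suc n)"
      by (simp add: hnth_kern[OF z] norm_divide norm_power power_divide mult.commute flip: power_mult del: of_nat_Suc)
    then have "(cmod (hnth (kern z) n))\<^sup>2 / real (Suc n) * r ^ (2 * n)
        = (cmod z ^ (2 * n) * r ^ (2 * n)) * (1 / (real (Suc n))\<^sup>2)"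
      by (simp add: power2_eq_square del: of_nat_Suc)
    also have "\<dots> \<le> 1 * (1 / (real (Suc n))\<^sup>2)"
      using z r by (intro mult_right_mono mult_le_one power_le_one) auto
    finally show "(cmod (hnth (kern z) n))\<^sup>2 / real (Suc n) * r ^ (2 * n) \<le> 1 / (real (Suc n))\<^sup>2"
      by simp
  qed
  also have "(\<Sum>n. ennreal (1 / (real (Suc n))\<^sup>2)) = ennreal inv_sq_sum"
    unfolding inv_sq_sum_def by (intro suminf_ennreal2 summable_inv_sq) simp
  also have "ennreal k * ennreal inv_sq_sum = ennreal (inv_sq_sum * k)"
    using inv_sq_sum_nonneg k0 by (simp add: ennreal_mult mult.commute)
  finally show ?thesis unfolding k_def by (simp add: mult_left_mono)
qed

section \<open>Integrating out one angle\<close>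

text \<open>Padding with zeros keeps all initial segments of the angles in the one space of real sequences,
  where the Borel sets of the product topology are the product \<open>\<sigma>\<close>-algebra.\<close>

definition past :: "nat \<Rightarrow> (nat \<Rightarrow> real) \<Rightarrow> nat \<Rightarrow> real" where
  "past N t = (\<lambda>i. if i < N then t i else 0)"

lemma measurable_nat_fun_component [measurable]:
  "(\<lambda>t :: nat \<Rightarrow> real. t i) \<in> borel_measurable borel"
  by (intro borel_measurable_continuous_onI continuous_on_product_coordinates)

text \<open>Fubini's theorem for the joint law of the first \<open>N\<close> angles and the next one, which is a product
  by independence.\<close>

lemma nn_integral_past_next:
  fixes \<theta> :: "nat \<Rightarrow> 'w \<Rightarrow> real" and g :: "(nat \<Rightarrow> real) \<times> real \<Rightarrow> ennreal"
  assumes M: "prob_space M"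
    and ind: "prob_space.indep_vars M (\<lambda>_. borel) \<theta> UNIV"
    and unif: "distr M borel (\<theta> N) = unif"
    and g[measurable]: "g \<in> borel_measurable (borel \<Otimes>\<^sub>M borel)"
  shows "(\<integral>\<^sup>+ \<omega>. g (past N (\<lambda>i. \<theta> i \<omega>), \<theta> N \<omega>) \<partial>M) =
    (\<integral>\<^sup>+ \<omega>. \<integral>\<^sup>+ s. g (past N (\<lambda>i. \<theta> i \<omega>), s) \<partial>unif \<partial>M)"
proof -
  interpret prob_space M by fact
  define P where "P \<omega> = past N (\<lambda>i. \<theta> i \<omega>)" for \<omega>
  have [measurable]: "\<theta> i \<in> borel_measurable M" for i
    using ind by (auto simp: indep_vars_def)
  have P[measurable]: "P \<in> borel_measurable M"
    unfolding P_def past_def by (rule measurable_coordinatewise_then_product) simp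
  have past[measurable]: "past N \<in> measurable (Pi\<^sub>M {..<N} (\<lambda>_. borel)) borel"
  proof (rule measurable_coordinatewise_then_product)
    show "(\<lambda>t. past N t i) \<in> borel_measurable (Pi\<^sub>M {..<N} (\<lambda>_. borel))" for i
      by (cases "i < N") (auto simp: past_def)
  qed
  \<comment> \<open>the next angle as a constant sequence, so that past and next angle have the same type\<close>
  define Q where "Q \<omega> = (\<lambda>_ :: nat. \<theta> N \<omega>)" for \<omega>
  have Q[measurable]: "Q \<in> borel_measurable M"
    unfolding Q_def by (rule measurable_coordinatewise_then_product) simp
  have last: "(\<lambda>x (_ :: nat). x N) \<in> measurable (Pi\<^sub>M {N} (\<lambda>_. borel :: real measure)) borel"
    by (rule measurable_coordinatewise_then_product) simp
  have "indep_var borel (past N \<circ> (\<lambda>\<omega>. restrict (\<lambda>i. \<theta> i \<omega>) {..<N}))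
      borel ((\<lambda>x (_ :: nat). x N) \<circ> (\<lambda>\<omega>. restrict (\<lambda>i. \<theta> i \<omega>) {N}))"
    by (rule indep_var_compose[OF indep_var_restrict[OF ind] past last]) auto
  also have "past N \<circ> (\<lambda>\<omega>. restrict (\<lambda>i. \<theta> i \<omega>) {..<N}) = P"
    by (auto simp: P_def past_def fun_eq_iff)
  also have "(\<lambda>x (_ :: nat). x N) \<circ> (\<lambda>\<omega>. restrict (\<lambda>i. \<theta> i \<omega>) {N}) = Q"
    by (auto simp: Q_def)
  finally have eq: "distr M (borel \<Otimes>\<^sub>M borel) (\<lambda>\<omega>. (P \<omega>, Q \<omega>)) = distr M borel P \<Otimes>\<^sub>M distr M borel Q"
    by (simp add: indep_var_distribution_eq)
  interpret U: prob_space "distr M borel Q" by (rule prob_space_distr) simp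
  define g' where "g' p = g (fst p, snd p 0)" for p :: "(nat \<Rightarrow> real) \<times> (nat \<Rightarrow> real)"
  have [measurable]: "g' \<in> borel_measurable (borel \<Otimes>\<^sub>M borel)"
    unfolding g'_def by measurable
  have "(\<integral>\<^sup>+ \<omega>. g (P \<omega>, \<theta> N \<omega>) \<partial>M) = (\<integral>\<^sup>+ p. g' p \<partial>distr M (borel \<Otimes>\<^sub>M borel) (\<lambda>\<omega>. (P \<omega>, Q \<omega>)))"
    by (subst nn_integral_distr) (simp_all add: g'_def, simp add: Q_def)
  also have "\<dots> = (\<integral>\<^sup>+ x. \<integral>\<^sup>+ y. g' (x, y) \<partial>distr M borel Q \<partial>distr M borel P)"
    unfolding eq by (rule U.nn_integral_fst[symmetric]) measurable
  also have "\<dots> = (\<integral>\<^sup>+ \<omega>. \<integral>\<^sup>+ y. g' (P \<omega>, y) \<partial>distr M borel Q \<partial>M)"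
    by (subst nn_integral_distr) auto
  also have "\<dots> = (\<integral>\<^sup>+ \<omega>. \<integral>\<^sup>+ s. g (P \<omega>, s) \<partial>unif \<partial>M)"
  proof (rule nn_integral_cong)
    fix \<omega>
    have "(\<integral>\<^sup>+ y. g' (P \<omega>, y) \<partial>distr M borel Q) = (\<integral>\<^sup>+ \<omega>'. g (P \<omega>, \<theta> N \<omega>') \<partial>M)"
      by (subst nn_integral_distr) (auto simp: g'_def Q_def)
    also have "\<dots> = (\<integral>\<^sup>+ s. g (P \<omega>, s) \<partial>distr M borel (\<theta> N))"
      by (subst nn_integral_distr) auto
    finally show "(\<integral>\<^sup>+ y. g' (P \<omega>, y) \<partial>distr M borel Q) = (\<integral>\<^sup>+ s. g (P \<omega>, s) \<partial>unif)"
      by (simp add: unif)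
  qed
  finally show ?thesis by (simp add: P_def)
qed

section \<open>Summable weights make the random points almost surely interpolating\<close>

text \<open>A tail of the sequence has a small Gram sum; the rest is finite. Coinciding points need no separate
  treatment: a pair of equal points contributes \<open>1\<close> to the sum, so there are none in the tail.\<close>

lemma universal_interpolating_if_gram_summable:
  fixes p :: "nat \<Rightarrow> complex"
  assumes p: "\<And>i. i \<in> I \<Longrightarrow> cmod (p i) < 1"
    and fin: "(\<Sum>i. \<Sum>j. ennreal (if i \<in> I \<and> j \<in> I \<and> i \<noteq> j then gram (p i) (p j) else 0)) < \<infinity>"
  shows "universal_interpolating (p ` I)"
proof -
  define Y where "Y i j = (if i \<in> I \<and> j \<in> I \<and> i \<noteq> j then gram (p i) (p j) else 0)" for i j
  have Y0: "0 \<le> Y i j" for i j by (simp add: Y_def gram_nonneg)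
  define f where "f i = enn2real (\<Sum>j. ennreal (Y i j))" for i
  have row: "(\<Sum>j. ennreal (Y i j)) = ennreal (f i)" for i
  proof -
    have "(\<Sum>j. ennreal (Y i j)) \<le> (\<Sum>i. \<Sum>j. ennreal (Y i j))"
      using sum_le_suminf[of "\<lambda>i. \<Sum>j. ennreal (Y i j)" "{i}"] by simp
    then have "(\<Sum>j. ennreal (Y i j)) < top"
      using fin unfolding Y_def[symmetric] by (simp add: le_less_trans)
    then show ?thesis by (simp add: f_def)
  qed
  have f0: "0 \<le> f i" for i
    by (simp add: f_def)
  have "(\<Sum>i. ennreal (f i)) \<noteq> top"
    using fin unfolding Y_def[symmetric] row by simp
  then have sf: "summable f"
    by (intro summable_suminf_not_top) (auto simp: f_def)
  have rowsum: "(\<Sum>j\<in>K. Y i j) \<le> f i" if "finite K" for i K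
  proof -
    have "ennreal (\<Sum>j\<in>K. Y i j) = (\<Sum>j\<in>K. ennreal (Y i j))"
      by (simp add: sum_ennreal Y0)
    also have "\<dots> \<le> ennreal (f i)"
      unfolding row[symmetric] using that by (intro sum_le_suminf) auto
    finally show ?thesis by (simp add: f_def)
  qed
  obtain N where N: "norm (\<Sum>i. f (i + N)) < 1 / 8"
    using suminf_exist_split[OF _ sf, of "1 / 8"] by auto
  have tail: "(\<Sum>i\<in>K. f i) \<le> 1 / 8" if K: "finite K" "K \<subseteq> {N..}" for K
  proof -
    have "inj_on (\<lambda>i. i - N) K"
    proof (rule inj_onI)
      fix x y assume "x \<in> K" "y \<in> K" "x - N = y - N"
      moreover then have "N \<le> x" "N \<le> y" using K by auto
      ultimately show "x = y" by linarith
    qed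
    then have "(\<Sum>i\<in>K. f i) = (\<Sum>k\<in>(\<lambda>i. i - N) ` K. f (k + N))"
      using K by (simp add: sum.reindex subset_iff)
    also have "\<dots> \<le> (\<Sum>k. f (k + N))"
      using K sf summable_iff_shift[of f N] by (intro sum_le_suminf) (simp_all add: f0)
    finally show ?thesis using N by simp
  qed
  define T where "T = p ` (I \<inter> {N..})"
  have "universal_interpolating T"
  proof (rule universal_interpolating_if_gram_small)
    show "T \<subseteq> ball 0 1" using p by (auto simp: T_def)
    fix F assume F: "finite F" "F \<subseteq> T"
    \<comment> \<open>one index for each point, to pass from sums over points to sums over indices\<close>
    define \<iota> where "\<iota> = inv_into (I \<inter> {N..}) p"
    have \<iota>: "\<iota> z \<in> I \<inter> {N..}" "p (\<iota> z) = z" if "z \<in> F" for z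
    proof -
      have z: "z \<in> p ` (I \<inter> {N..})" using that F(2) by (auto simp: T_def)
      show "\<iota> z \<in> I \<inter> {N..}" "p (\<iota> z) = z"
        unfolding \<iota>_def by (rule inv_into_into[OF z], rule f_inv_into_f[OF z])
    qed
    have inj: "inj_on \<iota> F"
      using \<iota>(2) by (metis inj_onI)
    have "(\<Sum>z\<in>F. \<Sum>w\<in>F - {z}. gram z w) \<le> (\<Sum>z\<in>F. \<Sum>j\<in>\<iota> ` F. Y (\<iota> z) j)"
    proof (rule sum_mono)
      fix z assume z: "z \<in> F"
      have "(\<Sum>w\<in>F - {z}. gram z w) = (\<Sum>w\<in>F - {z}. Y (\<iota> z) (\<iota> w))"
      proof (rule sum.cong[OF refl])
        fix w assume "w \<in> F - {z}"
        then show "gram z w = Y (\<iota> z) (\<iota> w)"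
          using \<iota>[OF z] \<iota>[of w] by (auto simp: Y_def)
      qed
      also have "\<dots> \<le> (\<Sum>w\<in>F. Y (\<iota> z) (\<iota> w))"
        using F by (intro sum_mono2) (auto simp: Y0)
      also have "\<dots> = (\<Sum>j\<in>\<iota> ` F. Y (\<iota> z) j)"
        by (simp add: sum.reindex[OF inj])
      finally show "(\<Sum>w\<in>F - {z}. gram z w) \<le> (\<Sum>j\<in>\<iota> ` F. Y (\<iota> z) j)" .
    qed
    also have "\<dots> \<le> (\<Sum>z\<in>F. f (\<iota> z))"
      using F by (intro sum_mono rowsum) auto
    also have "\<dots> = (\<Sum>i\<in>\<iota> ` F. f i)"
      by (simp add: sum.reindex[OF inj])
    also have "\<dots> \<le> 1 / 8"
      using F \<iota>(1) by (intro tail) auto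
    finally show "(\<Sum>z\<in>F. \<Sum>w\<in>F - {z}. gram z w) \<le> 1 / 8" .
  qed
  then have "universal_interpolating (p ` (I \<inter> {..<N}) \<union> T)"
    using p by (intro universal_interpolating_Un_finite) auto
  moreover have "p ` (I \<inter> {..<N}) \<union> T = p ` I"
    unfolding T_def image_Un[symmetric] by (rule arg_cong[where f="image p"]) auto
  ultimately show ?thesis by simp
qed

lemma borel_measurable_rcis [measurable]:
  assumes "f \<in> borel_measurable M"
  shows "(\<lambda>x. rcis r (f x)) \<in> borel_measurable M"
proof -
  have "rcis r \<in> borel_measurable borel"
    unfolding rcis_def[abs_def] cis_conv_exp by (intro borel_measurable_continuous_onI continuous_intros)
  from measurable_compose[OF assms this] show ?thesis .
qed

lemma borel_measurable_gram:
  assumes r: "0 \<le> r" "r < 1" "0 \<le> r'" "r' < 1"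
    and [measurable]: "f \<in> borel_measurable M" "g \<in> borel_measurable M"
  shows "(\<lambda>x. gram (rcis r (f x)) (rcis r' (g x))) \<in> borel_measurable M"
proof -
  have "gram (rcis r (f x)) (rcis r' (g x)) =
      (cmod (\<Sum>n. (cnj (rcis r (f x)) * rcis r' (g x)) ^ n / of_nat (Suc n)))\<^sup>2 * (kweight r * kweight r')" for x
    using sums_unique[OF ev_kern_sums[of "rcis r (f x)" "rcis r' (g x)"]] r
    by (simp add: gram_def kweight_def norm_kern_rcis del: of_nat_Suc)
  moreover have "(\<lambda>x. cnj (rcis r (f x))) \<in> borel_measurable M"
  proof -
    have "cnj (rcis r (f x)) = rcis r (- f x)" for x
      by (simp add: rcis_def cis_cnj)
    then show ?thesis by simp
  qed
  ultimately show ?thesis by simp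
qed

text \<open>Indices with \<open>\<rho> n = 0\<close> get weight \<open>0\<close>: however many there are, they give the single point \<open>0\<close>, which
  is added at the end.\<close>

lemma AE_universal_interpolating:
  fixes \<theta> :: "nat \<Rightarrow> 'w \<Rightarrow> real"
  assumes M: "prob_space M" and \<rho>: "\<And>n. 0 \<le> \<rho> n \<and> \<rho> n < 1"
    and ind: "prob_space.indep_vars M (\<lambda>_. borel) \<theta> UNIV"
    and unif: "\<And>n. distr M borel (\<theta> n) = unif"
    and W: "summable (\<lambda>n. if \<rho> n = 0 then 0 else kweight (\<rho> n))"
  shows "AE \<omega> in M. universal_interpolating (random_points \<rho> \<theta> \<omega>)"
proof -
  interpret prob_space M by fact
  define I where "I = {n. \<rho> n \<noteq> 0}"
  define w where "w n = (if \<rho> n = 0 then 0 else kweight (\<rho> n))" for n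
  define p where "p \<omega> n = rcis (\<rho> n) (\<theta> n \<omega>)" for \<omega> n
  define Y where "Y i j \<omega> = (if i \<in> I \<and> j \<in> I \<and> i \<noteq> j then gram (p \<omega> i) (p \<omega> j) else 0)" for i j \<omega>
  have w0: "0 \<le> w n" for n
    using kweight_pos \<rho> by (auto simp: w_def less_imp_le)
  have [measurable]: "\<theta> i \<in> borel_measurable M" for i
    using ind by (auto simp: indep_vars_def)
  have p1: "cmod (p \<omega> n) < 1" for \<omega> n
    using \<rho>[of n] by (simp add: p_def)
  have [measurable]: "Y i j \<in> borel_measurable M" for i j
  proof (cases "i \<in> I \<and> j \<in> I \<and> i \<noteq> j")
    case True
    then show ?thesis
      using \<rho> by (auto simp: Y_def[abs_def] p_def intro!: borel_measurable_gram)
  qed (auto simp: Y_def[abs_def])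
  have later: "(\<integral>\<^sup>+ \<omega>. ennreal (gram (p \<omega> i) (p \<omega> j)) \<partial>M) \<le> ennreal (inv_sq_sum * (kweight (\<rho> i) * kweight (\<rho> j)))"
    if "i < j" for i j
  proof -
    define g where "g q = ennreal (gram (rcis (\<rho> i) (fst q i)) (rcis (\<rho> j) (snd q)))" for q :: "(nat \<Rightarrow> real) \<times> real"
    have [measurable]: "(\<lambda>q :: (nat \<Rightarrow> real) \<times> real. fst q i) \<in> borel_measurable (borel \<Otimes>\<^sub>M borel)"
      by (rule measurable_compose[OF measurable_fst measurable_nat_fun_component])
    have "(\<lambda>q :: (nat \<Rightarrow> real) \<times> real. gram (rcis (\<rho> i) (fst q i)) (rcis (\<rho> j) (snd q))) \<in> borel_measurable (borel \<Otimes>\<^sub>M borel)"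
      using \<rho> by (intro borel_measurable_gram) auto
    then have [measurable]: "g \<in> borel_measurable (borel \<Otimes>\<^sub>M borel)"
      unfolding g_def by measurable
    have "(\<integral>\<^sup>+ \<omega>. ennreal (gram (p \<omega> i) (p \<omega> j)) \<partial>M) = (\<integral>\<^sup>+ \<omega>. g (past j (\<lambda>i. \<theta> i \<omega>), \<theta> j \<omega>) \<partial>M)"
      using that by (simp add: g_def past_def p_def)
    also have "\<dots> = (\<integral>\<^sup>+ \<omega>. \<integral>\<^sup>+ s. g (past j (\<lambda>i. \<theta> i \<omega>), s) \<partial>unif \<partial>M)"
      by (rule nn_integral_past_next[OF M ind unif]) measurable
    also have "\<dots> \<le> (\<integral>\<^sup>+ \<omega>. ennreal (inv_sq_sum * (kweight (\<rho> i) * kweight (\<rho> j))) \<partial>M)"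
    proof (rule nn_integral_mono)
      fix \<omega>
      have "(\<integral>\<^sup>+ s. g (past j (\<lambda>i. \<theta> i \<omega>), s) \<partial>unif) = (\<integral>\<^sup>+ s. ennreal (gram (p \<omega> i) (rcis (\<rho> j) s)) \<partial>unif)"
        using that by (simp add: g_def past_def p_def)
      also have "\<dots> \<le> ennreal (inv_sq_sum * (1 / (norm (kern (p \<omega> i)))\<^sup>2 * kweight (\<rho> j)))"
        using \<rho> by (intro circle_mean_gram_le p1) auto
      also have "1 / (norm (kern (p \<omega> i)))\<^sup>2 = kweight (\<rho> i)"
        using \<rho>[of i] by (simp add: p_def norm_kern_rcis kweight_def)
      finally show "(\<integral>\<^sup>+ s. g (past j (\<lambda>i. \<theta> i \<omega>), s) \<partial>unif) \<le> ennreal (inv_sq_sum * (kweight (\<rho> i) * kweight (\<rho> j)))" .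
    qed
    also have "\<dots> = ennreal (inv_sq_sum * (kweight (\<rho> i) * kweight (\<rho> j)))"
      by (simp add: emeasure_space_1)
    finally show ?thesis .
  qed
  have EY: "(\<integral>\<^sup>+ \<omega>. ennreal (Y i j \<omega>) \<partial>M) \<le> ennreal (inv_sq_sum * w i) * ennreal (w j)" for i j
  proof (cases "i \<in> I \<and> j \<in> I \<and> i \<noteq> j")
    case True
    then have "(\<integral>\<^sup>+ \<omega>. ennreal (Y i j \<omega>) \<partial>M) \<le> ennreal (inv_sq_sum * (kweight (\<rho> i) * kweight (\<rho> j)))"
      using later[of i j] later[of j i] gram_sym[OF p1 p1, of _ i _ j]
      by (cases "i < j") (auto simp: Y_def mult.commute)
    also have "inv_sq_sum * (kweight (\<rho> i) * kweight (\<rho> j)) = (inv_sq_sum * w i) * w j"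
      using True by (simp add: w_def I_def)
    also have "ennreal \<dots> = ennreal (inv_sq_sum * w i) * ennreal (w j)"
      by (intro ennreal_mult mult_nonneg_nonneg inv_sq_sum_nonneg w0)
    finally show ?thesis .
  qed (auto simp: Y_def)
  have "(\<integral>\<^sup>+ \<omega>. (\<Sum>i. \<Sum>j. ennreal (Y i j \<omega>)) \<partial>M) = (\<Sum>i. \<Sum>j. \<integral>\<^sup>+ \<omega>. ennreal (Y i j \<omega>) \<partial>M)"
    by (subst nn_integral_suminf, measurable, intro suminf_cong, subst nn_integral_suminf) auto
  also have "\<dots> \<le> (\<Sum>i. \<Sum>j. ennreal (inv_sq_sum * w i) * ennreal (w j))"
    by (intro suminf_le summableI EY)
  also have "\<dots> = (\<Sum>i. ennreal (inv_sq_sum * w i)) * (\<Sum>j. ennreal (w j))"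
    by simp
  also have "(\<Sum>j. ennreal (w j)) = ennreal (\<Sum>j. w j)"
    using W w0 by (intro suminf_ennreal2) (auto simp: w_def)
  also have "(\<Sum>i. ennreal (inv_sq_sum * w i)) = ennreal (\<Sum>i. inv_sq_sum * w i)"
    using W w0 inv_sq_sum_nonneg by (intro suminf_ennreal2 summable_mult) (auto simp: w_def)
  also have "ennreal (\<Sum>i. inv_sq_sum * w i) * ennreal (\<Sum>j. w j) < \<infinity>"
    by (simp add: ennreal_mult_less_top)
  finally have "AE \<omega> in M. (\<Sum>i. \<Sum>j. ennreal (Y i j \<omega>)) \<noteq> \<infinity>"
    by (intro nn_integral_noteq_infinite) auto
  then show ?thesis
  proof (eventually_elim)
    fix \<omega>
    assume "(\<Sum>i. \<Sum>j. ennreal (Y i j \<omega>)) \<noteq> \<infinity>"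
    then have "universal_interpolating (p \<omega> ` I)"
      using p1 unfolding Y_def by (intro universal_interpolating_if_gram_summable) (auto simp: less_top)
    moreover have "finite (p \<omega> ` (- I))"
      by (rule finite_subset[of _ "{0}"]) (auto simp: p_def I_def rcis_def)
    ultimately have "universal_interpolating (p \<omega> ` (- I) \<union> p \<omega> ` I)"
      using p1 by (intro universal_interpolating_Un_finite) auto
    also have "p \<omega> ` (- I) \<union> p \<omega> ` I = random_points \<rho> \<theta> \<omega>"
      unfolding random_points_def p_def image_Un[symmetric] by simp
    finally show "universal_interpolating (random_points \<rho> \<theta> \<omega>)" .
  qed
qed

section \<open>Distance from the constants to the span of random kernels\<close>

text \<open>The Gram-Schmidt process, without excluding linearly dependent vectors: when the new vector lies in
  the span of the old ones, \<open>u = 0\<close> and \<open>c = 0 / 0 = 0\<close>.\<close>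

lemma orthogonal_projection_coeffs:
  fixes v :: "'i \<Rightarrow> 'h::real_inner"
  assumes "finite J"
  shows "\<exists>\<alpha>. \<forall>p\<in>J. (x - (\<Sum>q\<in>J. \<alpha> q *\<^sub>R v q)) \<bullet> v p = 0"
  using assms
proof (induction J arbitrary: x)
  case empty
  then show ?case by simp
next
  case (insert r J)
  obtain \<alpha> where \<alpha>: "\<forall>p\<in>J. (x - (\<Sum>q\<in>J. \<alpha> q *\<^sub>R v q)) \<bullet> v p = 0"
    using insert.IH by blast
  obtain \<beta> where \<beta>: "\<forall>p\<in>J. (v r - (\<Sum>q\<in>J. \<beta> q *\<^sub>R v q)) \<bullet> v p = 0"
    using insert.IH by blast
  define h where "h = x - (\<Sum>q\<in>J. \<alpha> q *\<^sub>R v q)"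
  define u where "u = v r - (\<Sum>q\<in>J. \<beta> q *\<^sub>R v q)"
  define c where "c = (h \<bullet> u) / (u \<bullet> u)"
  define \<gamma> where "\<gamma> q = (if q = r then c else \<alpha> q - c * \<beta> q)" for q
  have "(\<Sum>q\<in>insert r J. \<gamma> q *\<^sub>R v q) = c *\<^sub>R v r + (\<Sum>q\<in>J. (\<alpha> q - c * \<beta> q) *\<^sub>R v q)"
    using insert.hyps by (simp add: \<gamma>_def) (intro sum.cong, auto)
  then have res: "x - (\<Sum>q\<in>insert r J. \<gamma> q *\<^sub>R v q) = h - c *\<^sub>R u"
    by (simp add: h_def u_def scaleR_diff_left scaleR_diff_right sum_subtractf scaleR_sum_right)
  have old: "(h - c *\<^sub>R u) \<bullet> v p = 0" if "p \<in> J" for p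
    using \<alpha> \<beta> that by (simp add: h_def u_def inner_diff_left)
  have "v r = u + (\<Sum>q\<in>J. \<beta> q *\<^sub>R v q)"
    by (simp add: u_def)
  then have "(h - c *\<^sub>R u) \<bullet> v r = (h - c *\<^sub>R u) \<bullet> u"
    using old by (simp add: inner_add_right inner_sum_right)
  also have "\<dots> = 0"
    by (cases "u = 0") (simp_all add: c_def inner_diff_left)
  finally have "(h - c *\<^sub>R u) \<bullet> v r = 0" .
  then show ?case
    using old res by (intro exI[of _ \<gamma>]) auto
qed

text \<open>The squared distance is an infimum of continuous functions of the vectors, hence upper
  semicontinuous; this is what makes it measurable in the angles below.\<close>

definition dist_sq :: "'i set \<Rightarrow> ('i \<Rightarrow> 'h::real_inner) \<Rightarrow> 'h \<Rightarrow> real" where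
  "dist_sq J v x = (INF \<alpha>. (norm (x - (\<Sum>q\<in>J. \<alpha> q *\<^sub>R v q)))\<^sup>2)"

lemma dist_sq_bdd: "bdd_below (range (\<lambda>\<alpha>. (norm (x - (\<Sum>q\<in>J. \<alpha> q *\<^sub>R v q)))\<^sup>2))"
  by (rule bdd_belowI2[of _ 0]) simp

lemma dist_sq_le: "dist_sq J v x \<le> (norm (x - (\<Sum>q\<in>J. \<alpha> q *\<^sub>R v q)))\<^sup>2"
  unfolding dist_sq_def by (rule cINF_lower[OF dist_sq_bdd]) simp

lemma dist_sq_greatest:
  "(\<And>\<alpha>. c \<le> (norm (x - (\<Sum>q\<in>J. \<alpha> q *\<^sub>R v q)))\<^sup>2) \<Longrightarrow> c \<le> dist_sq J v x"
  unfolding dist_sq_def by (rule cINF_greatest) auto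

lemma dist_sq_nonneg: "0 \<le> dist_sq J v x"
  by (rule dist_sq_greatest) simp

lemma dist_sq_le_norm: "dist_sq J v x \<le> (norm x)\<^sup>2"
  using dist_sq_le[of J v x "\<lambda>_. 0"] by simp

lemma dist_sq_antimono:
  assumes "finite J'" "J \<subseteq> J'"
  shows "dist_sq J' v x \<le> dist_sq J v x"
proof (rule dist_sq_greatest)
  fix \<alpha>
  have "(\<Sum>q\<in>J'. (if q \<in> J then \<alpha> q else 0) *\<^sub>R v q) = (\<Sum>q\<in>J. \<alpha> q *\<^sub>R v q)"
    using assms by (intro sum.mono_neutral_cong_right) auto
  then show "dist_sq J' v x \<le> (norm (x - (\<Sum>q\<in>J. \<alpha> q *\<^sub>R v q)))\<^sup>2"
    using dist_sq_le[of J' v x "\<lambda>q. if q \<in> J then \<alpha> q else 0"] by simp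
qed

lemma dist_sq_attained:
  assumes "finite J"
  obtains \<alpha> where "dist_sq J v x = (norm (x - (\<Sum>q\<in>J. \<alpha> q *\<^sub>R v q)))\<^sup>2"
    "\<And>p. p \<in> J \<Longrightarrow> (x - (\<Sum>q\<in>J. \<alpha> q *\<^sub>R v q)) \<bullet> v p = 0"
proof -
  obtain \<alpha> where \<alpha>: "\<forall>p\<in>J. (x - (\<Sum>q\<in>J. \<alpha> q *\<^sub>R v q)) \<bullet> v p = 0"
    using orthogonal_projection_coeffs[OF assms] by blast
  define h where "h = x - (\<Sum>q\<in>J. \<alpha> q *\<^sub>R v q)"
  have "(norm h)\<^sup>2 \<le> dist_sq J v x"
  proof (rule dist_sq_greatest)
    fix \<beta>
    define d where "d = (\<Sum>q\<in>J. (\<alpha> q - \<beta> q) *\<^sub>R v q)"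
    have "x - (\<Sum>q\<in>J. \<beta> q *\<^sub>R v q) = h + d"
      by (simp add: h_def d_def scaleR_diff_left sum_subtractf)
    moreover have "h \<bullet> d = 0"
      using \<alpha> by (simp add: d_def h_def inner_sum_right)
    then have "(norm (h + d))\<^sup>2 = (norm h)\<^sup>2 + (norm d)\<^sup>2"
      by (simp add: power2_norm_eq_inner inner_add_left inner_add_right inner_commute)
    ultimately show "(norm h)\<^sup>2 \<le> (norm (x - (\<Sum>q\<in>J. \<beta> q *\<^sub>R v q)))\<^sup>2"
      by simp
  qed
  then have "dist_sq J v x = (norm h)\<^sup>2"
    using dist_sq_le[of J v x \<alpha>] by (simp add: h_def)
  then show ?thesis using \<alpha> that unfolding h_def by blast
qed

lemma dist_sq_cong: "(\<And>p. p \<in> J \<Longrightarrow> v p = v' p) \<Longrightarrow> dist_sq J v x = dist_sq J v' x"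
  unfolding dist_sq_def by (simp cong: sum.cong)

lemma dist_sq_measurable:
  fixes v :: "'t::topological_space \<Rightarrow> 'i \<Rightarrow> 'h::real_inner"
  assumes v: "\<And>p. p \<in> J \<Longrightarrow> continuous_on UNIV (\<lambda>t. v t p)"
  shows "(\<lambda>t. dist_sq J (v t) x) \<in> borel_measurable borel"
proof (rule borel_measurableI_less)
  fix c
  have "continuous_on UNIV (\<lambda>t. (norm (x - (\<Sum>q\<in>J. \<alpha> q *\<^sub>R v t q)))\<^sup>2)" for \<alpha>
    by (intro continuous_intros v)
  then have "open {t. (norm (x - (\<Sum>q\<in>J. \<alpha> q *\<^sub>R v t q)))\<^sup>2 < c}" for \<alpha>
    by (intro open_Collect_less continuous_on_const)
  then have "open (\<Union>\<alpha>. {t. (norm (x - (\<Sum>q\<in>J. \<alpha> q *\<^sub>R v t q)))\<^sup>2 < c})"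
    by blast
  also have "(\<Union>\<alpha>. {t. (norm (x - (\<Sum>q\<in>J. \<alpha> q *\<^sub>R v t q)))\<^sup>2 < c}) = {t. dist_sq J (v t) x < c}"
    unfolding dist_sq_def by (auto simp: cINF_less_iff[OF UNIV_not_empty dist_sq_bdd])
  finally show "{t \<in> space borel. dist_sq J (v t) x < c} \<in> sets borel"
    by simp
qed

text \<open>The estimate \<open>\<bar>\<zeta>\<^sup>n - \<xi>\<^sup>n\<bar> \<le> n \<bar>\<zeta> - \<xi>\<bar>\<close> on the unit circle makes the kernel Lipschitz in \<open>cis s\<close>, because
  \<open>r < 1\<close> keeps the sum of the squared coefficients finite.\<close>

lemma continuous_kern_rcis:
  assumes r: "0 \<le> r" "r < 1"
  shows "continuous_on UNIV (\<lambda>s. kern (rcis r s))"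
proof -
  have r2: "norm (r\<^sup>2) < 1" using r by (simp add: abs_square_less_1)
  define B where "B = (\<Sum>n. real n * (r\<^sup>2) ^ n)"
  have summ: "summable (\<lambda>n. real n * (r\<^sup>2) ^ n)"
  proof (rule summable_comparison_test')
    show "summable (\<lambda>n. real (Suc n) * (r\<^sup>2) ^ n)"
      using geometric_deriv_sums[OF r2] by (simp add: sums_iff del: of_nat_Suc)
    show "norm (real n * (r\<^sup>2) ^ n) \<le> real (Suc n) * (r\<^sup>2) ^ n" for n
      by (simp add: abs_mult mult_right_mono)
  qed
  have lip: "(norm (kern (rcis r s) - kern (rcis r t)))\<^sup>2 \<le> (cmod (cis s - cis t))\<^sup>2 * B" for s t
  proof -
    have "(cmod (hnth (kern (rcis r s) - kern (rcis r t)) n))\<^sup>2 \<le> (cmod (cis s - cis t))\<^sup>2 * (real n * (r\<^sup>2) ^ n)" for n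
    proof -
      have "hnth (kern (rcis r s) - kern (rcis r t)) n = of_real (r ^ n / sqrt (real (Suc n))) * cnj (cis s ^ n - cis t ^ n)"
      proof -
        have "hnth (kern (rcis r s)) n = cnj (rcis r s) ^ n / of_real (sqrt (real (Suc n)))" for s
          by (rule hnth_kern) (use r in simp)
        then show ?thesis
          by (simp add: rcis_def power_mult_distrib diff_divide_distrib algebra_simps)
      qed
      then have "(cmod (hnth (kern (rcis r s) - kern (rcis r t)) n))\<^sup>2
          = (r\<^sup>2) ^ n / real (Suc n) * (cmod (cis s ^ n - cis t ^ n))\<^sup>2"
        using r by (simp add: norm_mult norm_divide norm_power power_mult_distrib power_divide mult.commute del: of_nat_Suc complex_cnj_diff
           flip: power_mult)
      also have "\<dots> \<le> (r\<^sup>2) ^ n / real (Suc n) * (real n * cmod (cis s - cis t))\<^sup>2"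
        by (intro mult_left_mono power_mono norm_power_diff) auto
      also have "\<dots> = (cmod (cis s - cis t))\<^sup>2 * (real n * (r\<^sup>2) ^ n) * (real n / real (Suc n))"
        by (simp add: power2_eq_square)
      also have "\<dots> \<le> (cmod (cis s - cis t))\<^sup>2 * (real n * (r\<^sup>2) ^ n) * 1"
        by (intro mult_left_mono) auto
      finally show ?thesis by simp
    qed
    then have "(norm (kern (rcis r s) - kern (rcis r t)))\<^sup>2 \<le> (\<Sum>n. (cmod (cis s - cis t))\<^sup>2 * (real n * (r\<^sup>2) ^ n))"
      unfolding norm_hseq_sq by (intro suminf_le summable_hnth summable_mult summ)
    also have "\<dots> = (cmod (cis s - cis t))\<^sup>2 * B"
      unfolding B_def by (rule suminf_mult[OF summ])
    finally show ?thesis .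
  qed
  have "((\<lambda>t. kern (rcis r t)) \<longlongrightarrow> kern (rcis r s)) (at s)" for s
  proof -
    have "((\<lambda>t. sqrt ((cmod (cis s - cis t))\<^sup>2 * B)) \<longlongrightarrow> sqrt ((cmod (cis s - cis s))\<^sup>2 * B)) (at s)"
      unfolding cis_conv_exp by (intro tendsto_intros)
    then have lim: "((\<lambda>t. sqrt ((cmod (cis s - cis t))\<^sup>2 * B)) \<longlongrightarrow> 0) (at s)"
      by simp
    have "norm (kern (rcis r t) - kern (rcis r s)) \<le> sqrt ((cmod (cis s - cis t))\<^sup>2 * B)" for t
      using lip[of s t] by (intro real_le_rsqrt) (simp add: norm_minus_commute)
    then have "\<forall>\<^sub>F t in at s. norm (kern (rcis r t) - kern (rcis r s)) \<le> sqrt ((cmod (cis s - cis t))\<^sup>2 * B)"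
      by (intro always_eventually allI)
    from Lim_null_comparison[OF this lim] show ?thesis
      by (rule LIM_zero_cancel)
  qed
  then show ?thesis by (simp add: continuous_on_def)
qed

lemma cmul_linear: "bounded_linear (cmul c)"
proof (rule bounded_linear_intro)
  show "cmul c (x + y) = cmul c x + cmul c y" for x y
    by (intro hseq_eqI) (simp add: algebra_simps)
  show "cmul c (r *\<^sub>R x) = r *\<^sub>R cmul c x" for r x
    by (intro hseq_eqI) simp
  show "norm (cmul c x) \<le> norm x * cmod c" for x
    by (simp add: norm_cmul)
qed

lemma continuous_nker_rcis:
  assumes r: "0 \<le> r" "r < 1"
  shows "continuous_on UNIV (\<lambda>s. nker (rcis r s, b))"
proof -
  note k = continuous_kern_rcis[OF r]
  show ?thesis
    by (cases b) (simp_all add: nker_def norm_kern_rcis[OF r] continuous_on_scaleR k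
        bounded_linear.continuous_on[OF cmul_linear k])
qed

text \<open>The squared distance from \<open>kern 0\<close>, which represents the constant function \<open>1\<close>, to the complex
  span of the kernels at the first \<open>N\<close> points. Points at the origin are left out because \<open>kern 0\<close> itself
  would be one of their kernels.\<close>

definition kernel_dist :: "(nat \<Rightarrow> real) \<Rightarrow> nat \<Rightarrow> (nat \<Rightarrow> real) \<Rightarrow> real" where
  "kernel_dist \<rho> N t = dist_sq ({i. i < N \<and> \<rho> i \<noteq> 0} \<times> (UNIV :: bool set))
     (\<lambda>(i, b). nker (rcis (\<rho> i) (t i), b)) (kern 0)"

lemma norm_kern_0: "norm (kern 0) = 1"
proof -
  have "(\<lambda>n. cmod 0 ^ (2 * n) / real (Suc n)) = (\<lambda>n. if n = 0 then 1 else 0)"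
    by (auto simp: fun_eq_iff power_0_left)
  then have "(norm (kern 0))\<^sup>2 = 1"
    using norm_kern_sq[of 0] sums_single[of 0 "\<lambda>_. 1 :: real"] by (simp add: sums_iff)
  then show ?thesis using power2_eq_imp_eq[of "norm (kern 0)" 1] by simp
qed

lemma kernel_dist_nonneg: "0 \<le> kernel_dist \<rho> N t"
  by (simp add: kernel_dist_def dist_sq_nonneg)

lemma kernel_dist_le_1: "kernel_dist \<rho> N t \<le> 1"
  unfolding kernel_dist_def by (rule order_trans[OF dist_sq_le_norm]) (simp add: norm_kern_0)

lemma kernel_dist_decreasing: "kernel_dist \<rho> (Suc N) t \<le> kernel_dist \<rho> N t"
  unfolding kernel_dist_def by (rule dist_sq_antimono) auto

lemma kernel_dist_cong:
  "(\<And>i. i < N \<Longrightarrow> t i = t' i) \<Longrightarrow> kernel_dist \<rho> N t = kernel_dist \<rho> N t'"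
  unfolding kernel_dist_def by (rule dist_sq_cong) auto

lemma kernel_dist_measurable:
  assumes \<rho>: "\<And>n. 0 \<le> \<rho> n \<and> \<rho> n < 1"
  shows "kernel_dist \<rho> N \<in> borel_measurable borel"
  unfolding kernel_dist_def[abs_def]
proof (rule dist_sq_measurable)
  fix p :: "nat \<times> bool"
  obtain i b where p: "p = (i, b)" by (cases p)
  have "continuous_on UNIV (\<lambda>t. nker (rcis (\<rho> i) (t i), b))"
    using \<rho>[of i] by (intro continuous_on_compose2[OF continuous_nker_rcis continuous_on_product_coordinates]) auto
  then show "continuous_on UNIV (\<lambda>t. case p of (i, b) \<Rightarrow> nker (rcis (\<rho> i) (t i), b))"
    by (simp add: p)
qed

text \<open>Projecting off one more kernel lowers the squared norm of the residual \<open>h\<close> by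
  \<open>\<bar>h(\<lambda>)\<bar>\<^sup>2 / \<parallel>k\<^sub>\<lambda>\<parallel>\<^sup>2\<close>, and the circular mean of \<open>\<bar>h\<bar>\<^sup>2\<close> is at least \<open>\<bar>h(0)\<bar>\<^sup>2\<close>. As \<open>h\<close> is the residual of
  the kernel at \<open>0\<close>, its value \<open>h(0)\<close> is itself the squared norm of \<open>h\<close>.\<close>

lemma kernel_dist_mean_decrease:
  assumes \<rho>: "\<And>n. 0 \<le> \<rho> n \<and> \<rho> n < 1" and N: "\<rho> N \<noteq> 0"
  shows "(\<integral>\<^sup>+ s. ennreal (kernel_dist \<rho> (Suc N) (x(N := s))) \<partial>unif) +
     ennreal (kweight (\<rho> N) * (kernel_dist \<rho> N x)\<^sup>2) \<le> ennreal (kernel_dist \<rho> N x)"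
proof -
  interpret prob_space unif by (rule prob_space_unif)
  define J where "J = {i. i < N \<and> \<rho> i \<noteq> 0} \<times> (UNIV :: bool set)"
  define v where "v t = (\<lambda>(i, b). nker (rcis (\<rho> i) (t i), b))" for t :: "nat \<Rightarrow> real"
  have J: "finite J" by (simp add: J_def)
  have KD: "kernel_dist \<rho> N x = dist_sq J (v x) (kern 0)"
    by (simp add: kernel_dist_def J_def v_def)
  obtain \<alpha> where \<alpha>: "dist_sq J (v x) (kern 0) = (norm (kern 0 - (\<Sum>q\<in>J. \<alpha> q *\<^sub>R v x q)))\<^sup>2"
    "\<And>p. p \<in> J \<Longrightarrow> (kern 0 - (\<Sum>q\<in>J. \<alpha> q *\<^sub>R v x q)) \<bullet> v x p = 0"
    using dist_sq_attained[OF J] by metis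
  define h where "h = kern 0 - (\<Sum>q\<in>J. \<alpha> q *\<^sub>R v x q)"
  have hd: "kernel_dist \<rho> N x = (norm h)\<^sup>2"
    by (simp add: KD \<alpha>(1) h_def)
  have "h \<bullet> (\<Sum>q\<in>J. \<alpha> q *\<^sub>R v x q) = 0"
    using \<alpha>(2) by (simp add: h_def inner_sum_right)
  then have "h \<bullet> kern 0 = h \<bullet> h"
    by (simp add: h_def inner_diff_right)
  then have "Re (ev h 0) = kernel_dist \<rho> N x"
    using inner_kern(1)[of 0 h] by (simp add: hd power2_norm_eq_inner)
  moreover have "ev h 0 = hnth h 0"
    using ev_bshift[of 0 h] by simp
  ultimately have h0: "kernel_dist \<rho> N x \<le> cmod (hnth h 0)"
    using complex_Re_le_cmod[of "hnth h 0"] by simp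
  let ?k = "kweight (\<rho> N)"
  have k: "0 < ?k" using \<rho> kweight_pos by blast
  have step: "kernel_dist \<rho> (Suc N) (x(N := s)) + ?k * (cmod (ev h (rcis (\<rho> N) s)))\<^sup>2 \<le> (norm h)\<^sup>2" for s
  proof -
    define z where "z = rcis (\<rho> N) s"
    have z: "cmod z < 1" using \<rho>[of N] by (simp add: z_def)
    define a b where "a = h \<bullet> nker (z, True)" and "b = h \<bullet> nker (z, False)"
    define \<beta> where "\<beta> q = (if fst q = N then h \<bullet> nker (z, snd q) else \<alpha> q)" for q
    define J' where "J' = {i. i < Suc N \<and> \<rho> i \<noteq> 0} \<times> (UNIV :: bool set)"
    have J': "J' = insert (N, True) (insert (N, False) J)"
      using N by (auto simp: J'_def J_def less_Suc_eq)
    have new: "(N, True) \<notin> insert (N, False) J" "(N, False) \<notin> J"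
      by (auto simp: J_def)
    have "(\<Sum>q\<in>J. \<beta> q *\<^sub>R v (x(N := s)) q) = (\<Sum>q\<in>J. \<alpha> q *\<^sub>R v x q)"
      by (rule sum.cong[OF refl]) (auto simp: \<beta>_def v_def J_def)
    then have "kern 0 - (\<Sum>q\<in>J'. \<beta> q *\<^sub>R v (x(N := s)) q) = h - a *\<^sub>R nker (z, True) - b *\<^sub>R nker (z, False)"
      unfolding J' using J new by (simp add: \<beta>_def v_def h_def a_def b_def z_def)
    then have "kernel_dist \<rho> (Suc N) (x(N := s)) \<le> (norm (h - a *\<^sub>R nker (z, True) - b *\<^sub>R nker (z, False)))\<^sup>2"
      using dist_sq_le[of J' "v (x(N := s))" "kern 0" \<beta>] by (simp add: kernel_dist_def J'_def v_def)
    also have "\<dots> = (norm h)\<^sup>2 - (a\<^sup>2 + b\<^sup>2)"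
    proof -
      have n: "nker (z, c) \<bullet> nker (z, c) = 1" for c
        using norm_nker[OF z] by (simp add: norm_eq_1)
      have o: "nker (z, True) \<bullet> nker (z, False) = 0" "nker (z, False) \<bullet> nker (z, True) = 0"
        by (auto intro: nker_orthogonal)
      have ab: "nker (z, True) \<bullet> h = a" "nker (z, False) \<bullet> h = b" "h \<bullet> nker (z, True) = a" "h \<bullet> nker (z, False) = b"
        by (simp_all add: a_def b_def inner_commute)
      show ?thesis
        unfolding power2_norm_eq_inner inner_diff_left inner_diff_right inner_scaleR_left inner_scaleR_right n o ab
        by (simp add: power2_eq_square)
    qed
    also have "a\<^sup>2 + b\<^sup>2 = ?k * (cmod (ev h z))\<^sup>2"
      using sum_inner_nker_sq[OF z, of h] \<rho>[of N]
      by (simp add: UNIV_bool a_def b_def norm_divide power_divide kweight_def z_def norm_kern_rcis add.commute)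
    finally show ?thesis unfolding z_def by linarith
  qed
  have dist_meas: "(\<lambda>s. ennreal (kernel_dist \<rho> (Suc N) (x(N := s)))) \<in> borel_measurable unif"
  proof (rule measurable_compose[OF measurable_compose[OF _ kernel_dist_measurable[OF \<rho>]] measurable_ennreal])
    show "(\<lambda>s. x(N := s)) \<in> borel_measurable unif"
      unfolding measurable_cong_sets[OF sets_unif refl]
      by (rule measurable_coordinatewise_then_product) (simp add: fun_upd_def)
  qed
  have "(\<lambda>s. ev h (rcis (\<rho> N) s)) \<in> borel_measurable borel"
    by (rule borel_measurable_ev_rcis) (use \<rho>[of N] in auto)
  then have ev_meas: "(\<lambda>s. ennreal ((cmod (ev h (rcis (\<rho> N) s)))\<^sup>2)) \<in> borel_measurable unif"
    and ev_meas': "(\<lambda>s. ennreal (?k * (cmod (ev h (rcis (\<rho> N) s)))\<^sup>2)) \<in> borel_measurable unif"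
    unfolding measurable_cong_sets[OF sets_unif refl]
    by (auto dest: measurable_compose[of _ _ _ "\<lambda>z. ennreal ((cmod z)\<^sup>2)" borel]
         measurable_compose[of _ _ _ "\<lambda>z. ennreal (?k * (cmod z)\<^sup>2)" borel])
  define F where "F n = ennreal ((cmod (hnth h n))\<^sup>2 / real (Suc n) * \<rho> N ^ (2 * n))" for n
  have "ennreal ((kernel_dist \<rho> N x)\<^sup>2) \<le> ennreal ((cmod (hnth h 0))\<^sup>2)"
    by (intro ennreal_leI power_mono h0 kernel_dist_nonneg)
  also have "ennreal ((cmod (hnth h 0))\<^sup>2) = F 0"
    by (simp add: F_def)
  also have "F 0 \<le> (\<Sum>n. F n)"
    using sum_le_suminf[of F "{0}"] by (simp add: summableI)
  also have "\<dots> = (\<integral>\<^sup>+ s. ennreal ((cmod (ev h (rcis (\<rho> N) s)))\<^sup>2) \<partial>unif)"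
    unfolding F_def by (rule circle_mean_ev[symmetric]) (use \<rho>[of N] in auto)
  finally have mean: "ennreal ((kernel_dist \<rho> N x)\<^sup>2) \<le> (\<integral>\<^sup>+ s. ennreal ((cmod (ev h (rcis (\<rho> N) s)))\<^sup>2) \<partial>unif)" .
  have "ennreal (?k * (kernel_dist \<rho> N x)\<^sup>2) = ennreal ?k * ennreal ((kernel_dist \<rho> N x)\<^sup>2)"
    using k by (intro ennreal_mult) auto
  also have "\<dots> \<le> ennreal ?k * (\<integral>\<^sup>+ s. ennreal ((cmod (ev h (rcis (\<rho> N) s)))\<^sup>2) \<partial>unif)"
    by (rule mult_left_mono[OF mean]) simp
  also have "\<dots> = (\<integral>\<^sup>+ s. ennreal (?k * (cmod (ev h (rcis (\<rho> N) s)))\<^sup>2) \<partial>unif)"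
    using k by (simp add: ennreal_mult nn_integral_cmult[OF ev_meas])
  finally have "(\<integral>\<^sup>+ s. ennreal (kernel_dist \<rho> (Suc N) (x(N := s))) \<partial>unif) + ennreal (?k * (kernel_dist \<rho> N x)\<^sup>2)
      \<le> (\<integral>\<^sup>+ s. ennreal (kernel_dist \<rho> (Suc N) (x(N := s))) \<partial>unif) +
         (\<integral>\<^sup>+ s. ennreal (?k * (cmod (ev h (rcis (\<rho> N) s)))\<^sup>2) \<partial>unif)"
    by (rule add_left_mono)
  also have "\<dots> = (\<integral>\<^sup>+ s. ennreal (kernel_dist \<rho> (Suc N) (x(N := s)) + ?k * (cmod (ev h (rcis (\<rho> N) s)))\<^sup>2) \<partial>unif)"
    using k by (subst nn_integral_add[symmetric, OF dist_meas ev_meas'])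
      (simp add: ennreal_plus kernel_dist_nonneg del: fun_upd_apply)
  also have "\<dots> \<le> (\<integral>\<^sup>+ s. ennreal ((norm h)\<^sup>2) \<partial>unif)"
    by (intro nn_integral_mono ennreal_leI step)
  also have "\<dots> = ennreal (kernel_dist \<rho> N x)"
    using emeasure_space_1 by (simp add: hd)
  finally show ?thesis .
qed

text \<open>A function that vanishes at the points but not at \<open>0\<close> is orthogonal to their kernels and not to
  the kernel at \<open>0\<close>, which keeps the distance away from zero.\<close>

lemma kernel_dist_lower_bound:
  assumes \<rho>: "\<And>n. 0 \<le> \<rho> n \<and> \<rho> n < 1"
    and Z: "zero_sequence ((\<lambda>n. rcis (\<rho> n) (t n)) ` UNIV)"
  shows "\<exists>\<delta>>0. \<forall>N. \<delta> \<le> kernel_dist \<rho> N t"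
proof -
  define \<Lambda> where "\<Lambda> = (\<lambda>n. rcis (\<rho> n) (t n)) ` {n. \<rho> n \<noteq> 0}"
  have L: "\<Lambda> \<subseteq> ball 0 1" using \<rho> by (auto simp: \<Lambda>_def)
  have 0: "0 \<in> ball (0 :: complex) 1" "0 \<notin> \<Lambda>"
    by (auto simp: \<Lambda>_def rcis_def)
  obtain a0 z0 where a0: "\<And>z. z \<in> (\<lambda>n. rcis (\<rho> n) (t n)) ` UNIV \<Longrightarrow> ev a0 z = 0" "z0 \<in> ball 0 1" "ev a0 z0 \<noteq> 0"
    using zero_sequence_ev[OF Z] by blast
  have "\<And>z. z \<in> \<Lambda> \<Longrightarrow> ev a0 z = 0" using a0(1) by (auto simp: \<Lambda>_def)
  then obtain b where b: "\<forall>z\<in>\<Lambda>. ev b z = 0" "ev b 0 \<noteq> 0"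
    using zero_free_at_new_point[OF L 0 _ a0(2,3)] by blast
  define a where "a = cmul (1 / ev b 0) b"
  have a: "ev a z = 0" if "z \<in> \<Lambda>" for z
    using b that L by (auto simp: a_def ev_cmul subset_iff)
  have a1: "a \<bullet> kern 0 = 1"
    using b(2) by (simp add: inner_kern a_def ev_cmul)
  then have anz: "0 < norm a" by auto
  have "1 / (norm a)\<^sup>2 \<le> kernel_dist \<rho> N t" for N
    unfolding kernel_dist_def
  proof (rule dist_sq_greatest)
    fix \<alpha> :: "nat \<times> bool \<Rightarrow> real"
    let ?J = "{i. i < N \<and> \<rho> i \<noteq> 0} \<times> (UNIV :: bool set)"
    let ?v = "\<lambda>(i, b). nker (rcis (\<rho> i) (t i), b)"
    let ?h = "kern 0 - (\<Sum>q\<in>?J. \<alpha> q *\<^sub>R ?v q)"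
    have "a \<bullet> ?v q = 0" if q_in: "q \<in> ?J" for q
    proof -
      obtain i c where q: "q = (i, c)" "\<rho> i \<noteq> 0" using q_in by (cases q) auto
      have "cmod (rcis (\<rho> i) (t i)) < 1" using \<rho>[of i] by simp
      moreover have "ev a (rcis (\<rho> i) (t i)) = 0" using q by (intro a) (auto simp: \<Lambda>_def)
      ultimately show ?thesis using q by (cases c) (simp_all add: inner_nker)
    qed
    then have "a \<bullet> ?h = 1"
      by (simp add: inner_diff_right inner_sum_right a1)
    then have "1 \<le> norm a * norm ?h"
      using norm_cauchy_schwarz[of a ?h] by simp
    then have "1\<^sup>2 \<le> (norm a * norm ?h)\<^sup>2"
      by (intro power_mono) auto
    then show "1 / (norm a)\<^sup>2 \<le> (norm ?h)\<^sup>2"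
      using anz by (simp add: power_mult_distrib divide_le_eq mult.commute)
  qed
  then show ?thesis using anz by (intro exI[of _ "1 / (norm a)\<^sup>2"]) auto
qed

section \<open>Random zero sequences have summable weights\<close>

text \<open>With \<open>y N\<close> the mean square of the distance, the mean decreases telescope to a bound for the sum of
  \<open>w n * y n\<close>. As \<open>y\<close> is decreasing, a divergent sum of weights forces the limit \<open>L\<close> of the mean squares,
  and with it the limiting distance, to be zero.\<close>

lemma summable_weights_if_AE_zero_sequence:
  fixes \<theta> :: "nat \<Rightarrow> 'w \<Rightarrow> real"
  assumes M: "prob_space M" and \<rho>: "\<And>n. 0 \<le> \<rho> n \<and> \<rho> n < 1"
    and ind: "prob_space.indep_vars M (\<lambda>_. borel) \<theta> UNIV"
    and unif: "\<And>n. distr M borel (\<theta> n) = unif"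
    and Z: "AE \<omega> in M. zero_sequence (random_points \<rho> \<theta> \<omega>)"
  shows "summable (\<lambda>n. if \<rho> n = 0 then 0 else kweight (\<rho> n))"
proof (rule ccontr)
  interpret prob_space M by fact
  define w where "w n = (if \<rho> n = 0 then 0 else kweight (\<rho> n))" for n
  assume "\<not> ?thesis"
  then have nsum: "\<not> summable w" by (simp add: w_def[abs_def])
  have w0: "0 \<le> w n" for n
    using kweight_pos \<rho> by (auto simp: w_def less_imp_le)
  have [measurable]: "\<theta> i \<in> borel_measurable M" for i
    using ind by (auto simp: indep_vars_def)
  have [measurable]: "kernel_dist \<rho> N \<in> borel_measurable borel" for N
    by (rule kernel_dist_measurable[OF \<rho>])
  define D where "D N \<omega> = kernel_dist \<rho> N (\<lambda>i. \<theta> i \<omega>)" for N \<omega>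
  have [measurable]: "(\<lambda>\<omega> i. \<theta> i \<omega>) \<in> borel_measurable M"
    by (rule measurable_coordinatewise_then_product) simp
  have [measurable]: "D N \<in> borel_measurable M" for N
    unfolding D_def by measurable
  have D0: "0 \<le> D N \<omega>" and D1: "D N \<omega> \<le> 1" for N \<omega>
    by (simp_all add: D_def kernel_dist_nonneg kernel_dist_le_1)
  have Ddec: "D m \<omega> \<le> D n \<omega>" if "n \<le> m" for m n \<omega>
    using that by (rule lift_Suc_antimono_le[of "\<lambda>n. D n \<omega>", rotated]) (simp add: D_def kernel_dist_decreasing)
  define e y where "e N = (\<integral>\<^sup>+ \<omega>. ennreal (D N \<omega>) \<partial>M)" and "y N = (\<integral>\<^sup>+ \<omega>. ennreal ((D N \<omega>)\<^sup>2) \<partial>M)" for N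
  have decrease: "e (Suc N) + ennreal (w N) * y N \<le> e N" for N
  proof (cases "\<rho> N = 0")
    case True
    then show ?thesis
      by (simp add: w_def e_def nn_integral_mono ennreal_leI Ddec)
  next
    case False
    define P where "P \<omega> = past N (\<lambda>i. \<theta> i \<omega>)" for \<omega>
    define g where "g q = ennreal (kernel_dist \<rho> (Suc N) ((fst q)(N := snd q)))" for q
    have "(\<lambda>q :: (nat \<Rightarrow> real) \<times> real. (fst q)(N := snd q)) \<in> borel_measurable (borel \<Otimes>\<^sub>M borel)"
      by (rule measurable_coordinatewise_then_product) (simp add: fun_upd_def)
    then have [measurable]: "g \<in> borel_measurable (borel \<Otimes>\<^sub>M borel)"
      unfolding g_def by measurable
    have "D (Suc N) \<omega> = kernel_dist \<rho> (Suc N) ((P \<omega>)(N := \<theta> N \<omega>))" for \<omega>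
      unfolding D_def by (rule kernel_dist_cong) (auto simp: P_def past_def)
    then have "e (Suc N) = (\<integral>\<^sup>+ \<omega>. g (past N (\<lambda>i. \<theta> i \<omega>), \<theta> N \<omega>) \<partial>M)"
      by (simp add: e_def g_def P_def)
    also have "\<dots> = (\<integral>\<^sup>+ \<omega>. \<integral>\<^sup>+ s. g (past N (\<lambda>i. \<theta> i \<omega>), s) \<partial>unif \<partial>M)"
      by (rule nn_integral_past_next[OF M ind unif]) measurable
    finally have e1: "e (Suc N) = (\<integral>\<^sup>+ \<omega>. \<integral>\<^sup>+ s. g (P \<omega>, s) \<partial>unif \<partial>M)"
      by (simp add: P_def)
    have DP: "D N \<omega> = kernel_dist \<rho> N (P \<omega>)" for \<omega>
      unfolding D_def by (rule kernel_dist_cong) (auto simp: P_def past_def)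
    interpret U: prob_space unif by (rule prob_space_unif)
    have [measurable]: "P \<in> borel_measurable M"
      unfolding P_def past_def by (rule measurable_coordinatewise_then_product) simp
    have "e (Suc N) + ennreal (w N) * y N =
        (\<integral>\<^sup>+ \<omega>. (\<integral>\<^sup>+ s. g (P \<omega>, s) \<partial>unif) + ennreal (w N) * ennreal ((D N \<omega>)\<^sup>2) \<partial>M)"
      unfolding e1 y_def by (subst nn_integral_add) (auto simp: nn_integral_cmult)
    also have "\<dots> \<le> (\<integral>\<^sup>+ \<omega>. ennreal (D N \<omega>) \<partial>M)"
    proof (rule nn_integral_mono)
      fix \<omega>
      show "(\<integral>\<^sup>+ s. g (P \<omega>, s) \<partial>unif) + ennreal (w N) * ennreal ((D N \<omega>)\<^sup>2) \<le> ennreal (D N \<omega>)"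
        using kernel_dist_mean_decrease[of \<rho> N "P \<omega>", OF \<rho> False] w0[of N] False
        by (simp add: g_def DP w_def ennreal_mult)
    qed
    finally show ?thesis by (simp add: e_def)
  qed
  have "e N + (\<Sum>n<N. ennreal (w n) * y n) \<le> 1" for N
  proof (induction N)
    case 0
    have "e 0 \<le> (\<integral>\<^sup>+ \<omega>. 1 \<partial>M)"
      unfolding e_def using D1 by (intro nn_integral_mono) (simp add: ennreal_le_1)
    then show ?case by (simp add: emeasure_space_1)
  next
    case (Suc N)
    have "e (Suc N) + (\<Sum>n<Suc N. ennreal (w n) * y n) = (e (Suc N) + ennreal (w N) * y N) + (\<Sum>n<N. ennreal (w n) * y n)"
      by (simp add: add_ac)
    also have "\<dots> \<le> e N + (\<Sum>n<N. ennreal (w n) * y n)"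
      by (intro add_right_mono decrease)
    finally show ?case using Suc by (rule order_trans)
  qed
  then have sum1: "(\<Sum>n<N. ennreal (w n) * y n) \<le> 1" for N
    by (meson order_trans le_add2 add_increasing zero_le order_refl)
  have ydec: "y N \<le> y n" if "n \<le> N" for n N
    unfolding y_def using that D0 Ddec by (intro nn_integral_mono ennreal_leI power_mono)
  define L where "L = (\<integral>\<^sup>+ \<omega>. (INF N. ennreal ((D N \<omega>)\<^sup>2)) \<partial>M)"
  have Ly: "L \<le> y N" for N
    unfolding L_def y_def by (intro nn_integral_mono INF_lower) simp
  have "ennreal (\<Sum>n<N. w n) * L \<le> 1" for N
  proof -
    have "ennreal (\<Sum>n<N. w n) * L = (\<Sum>n<N. ennreal (w n) * L)"
      unfolding sum_distrib_right[symmetric] by (subst sum_ennreal) (simp_all add: w0)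
    also have "\<dots> \<le> (\<Sum>n<N. ennreal (w n) * y n)"
      by (intro sum_mono mult_left_mono Ly) simp
    finally show ?thesis using sum1 by (rule order_trans)
  qed
  moreover have "L \<le> y 0" by (rule Ly)
  then have "L \<le> 1"
  proof (rule order_trans)
    have "y 0 \<le> (\<integral>\<^sup>+ \<omega>. 1 \<partial>M)"
      unfolding y_def using D0 D1 by (intro nn_integral_mono) (simp add: ennreal_le_1 power_le_one)
    then show "y 0 \<le> 1" by (simp add: emeasure_space_1)
  qed
  then obtain l where l: "L = ennreal l" "0 \<le> l"
    by (cases L) (auto simp: top_unique)
  ultimately have bound: "(\<Sum>n<N. w n) * l \<le> 1" for N
    using w0 by (simp add: ennreal_mult[symmetric] sum_nonneg ennreal_le_1)
  have "l = 0"
  proof (rule ccontr)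
    assume "l \<noteq> 0"
    then have "(\<Sum>n<N. w n) \<le> 1 / l" for N
      using bound l(2) by (simp add: pos_le_divide_eq)
    then have "summable w"
      by (intro summableI_nonneg_bounded[of _ "1 / l"] w0)
    then show False using nsum by simp
  qed
  then have "(\<integral>\<^sup>+ \<omega>. (INF N. ennreal ((D N \<omega>)\<^sup>2)) \<partial>M) = 0"
    using l(1) by (simp add: L_def)
  moreover have "(\<lambda>\<omega>. INF N. ennreal ((D N \<omega>)\<^sup>2)) \<in> borel_measurable M"
    by measurable
  ultimately have "AE \<omega> in M. (INF N. ennreal ((D N \<omega>)\<^sup>2)) = 0"
    using nn_integral_0_iff_AE by blast
  moreover have "AE \<omega> in M. (INF N. ennreal ((D N \<omega>)\<^sup>2)) \<noteq> 0"
    using Z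
  proof (eventually_elim)
    fix \<omega>
    assume "zero_sequence (random_points \<rho> \<theta> \<omega>)"
    then obtain \<delta> where \<delta>: "0 < \<delta>" "\<And>N. \<delta> \<le> D N \<omega>"
      using kernel_dist_lower_bound[of \<rho> "\<lambda>i. \<theta> i \<omega>", OF \<rho>] unfolding random_points_def D_def by blast
    have "ennreal (\<delta>\<^sup>2) \<le> (INF N. ennreal ((D N \<omega>)\<^sup>2))"
      using \<delta> by (intro INF_greatest ennreal_leI power_mono) auto
    then show "(INF N. ennreal ((D N \<omega>)\<^sup>2)) \<noteq> 0"
      using \<delta>(1) by auto
  qed
  ultimately have "AE \<omega> in M. False"
    by eventually_elim simp
  then show False by simp
qed

section \<open>Almost sure interpolation and almost sure zeros\<close>

theorem corollary1p9:
  fixes M :: "'w measure" and \<rho> :: "nat \<Rightarrow> real" and \<theta> :: "nat \<Rightarrow> 'w \<Rightarrow> real"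
  assumes "prob_space M"
    and "\<And>n. 0 \<le> \<rho> n \<and> \<rho> n < 1"
    and "prob_space.indep_vars M (\<lambda>_. borel) \<theta> UNIV"
    and "\<And>n. distr M borel (\<theta> n) = uniform_measure lborel {0..2 * pi}"
  shows "(AE \<omega> in M. universal_interpolating (random_points \<rho> \<theta> \<omega>)) \<longleftrightarrow>
         (AE \<omega> in M. zero_sequence (random_points \<rho> \<theta> \<omega>))"
proof
  assume "AE \<omega> in M. universal_interpolating (random_points \<rho> \<theta> \<omega>)"
  then show "AE \<omega> in M. zero_sequence (random_points \<rho> \<theta> \<omega>)"
    by eventually_elim (rule universal_interpolating_imp_zero_sequence)
next
  have unif: "\<And>n. distr M borel (\<theta> n) = unif"
    unfolding unif_def by (rule assms(4))
  assume "AE \<omega> in M. zero_sequence (random_points \<rho> \<theta> \<omega>)"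
  then have "summable (\<lambda>n. if \<rho> n = 0 then 0 else kweight (\<rho> n))"
    by (rule summable_weights_if_AE_zero_sequence[OF assms(1,2,3) unif])
  then show "AE \<omega> in M. universal_interpolating (random_points \<rho> \<theta> \<omega>)"
    by (rule AE_universal_interpolating[OF assms(1,2,3) unif])
qed

end
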